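(* (i) Let $\phi_*^{(N)}$ be an optimal sequence of decision rules such that $$\phi_*^{(N)}=\arg\min_{\phi^{(N)}}P_{e,N}(\phi^{(N)},Q_0^{(N)},Q_1^{(N)}).$$ Then $\phi_*^{(N)}$ minimizes $P_N^{\mathrm{DD}}(\cdot)$. (ii) Similarly, for each $k\ge1$ define $\psi_{*,k}$ recursively as $$\psi_{*,k}=\arg\min_{\psi_k}P_{e,k}\big((\psi_*^{(k-1)},\psi_k),Q_0^{(k)},Q_1^{(k)}\big),$$ where $\psi_*^{(k-1)}=(\psi_{*,1},\dots,\psi_{*,k-1})$ (empty for $k=1$). Then $\psi_{*,k}$ minimizes $P_k^{\mathrm{SL}}(\cdot\mid\psi_*^{(k-1)})$ for all $k\ge1$.
   Context: Tandem network: agents $1,\dots,N$; the true hypothesis $H$ is $H_i$ with prior probability $\pi_i\in(0,1)$, $i=0,1$, $\pi_0+\pi_1=1$. Conditioned on $H=H_i$, agent $k$ observes $Y_k$ in a measurable space $(\mathcal{Y},\mathcal{A})$ with (unknown) distribution $P_{i,k}$ in the uncertainty class $\mathcal{P}_{i,k}=\{(1-\epsilon_{i,k})P_i^*+\epsilon_{i,k}R : R\in\mathcal{R}\}$, where $\mathcal{R}$ is the set of all probability measures on $(\mathcal{Y},\mathcal{A})$, $P_i^*\in\mathcal{R}$ is the nominal distribution (the same for all agents), and the contamination $\epsilon_{i,k}\in[0,1)$ is small enough that $\mathcal{P}_{0,k}$ and $\mathcal{P}_{1,k}$ are disjoint. All distributions in $\mathcal{P}_{0,k}$ and $\mathcal{P}_{1,k}$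 are assumed absolutely continuous with respect to one another. Given $H$, the observations are independent across agents. Agent $k$ decides $U_k=\phi_k(Y_k,U_{k-1})\in\{0,1\}$, with $U_0\equiv 0$, where $\phi_k$ is its decision rule; $\phi^{(k)}=(\phi_1,\dots,\phi_k)$. $\mathcal{P}_i^{(k)}=\mathcal{P}_{i,1}\times\cdots\times\mathcal{P}_{i,k}$; an element $P_i^{(k)}=P_{i,1}\times\cdots\times P_{i,k}$ is the product law of $(Y_1,\dots,Y_k)$ under $H_i$. The error probability of agent $k$ is $P_{e,k}(\phi^{(k)},P_0^{(k)},P_1^{(k)})=\pi_0P_0^{(k)}(U_k=1)+\pi_1P_1^{(k)}(U_k=0)$. Decentralized detection criterion: $P_N^{\mathrm{DD}}(\phi^{(N)})=\sup_{(P_0^{(N)},P_1^{(N)})\in\mathcal{P}_0^{(N)}\times\mathcal{P}_1^{(N)}}P_{e,N}(\phi^{(N)},P_0^{(N)},P_1^{(N)})$. Social learning criterion of agent $k$ given the previous rules: $P_k^{\mathrm{SL}}(\phi_k\mid\phi^{(k-1)})=\sup_{(P_0^{(k)},P_1^{(k)})\in\mathcal{P}_0^{(k)}\times\mathcal{P}_1^{(k)}}P_{e,k}(\phi^{(k)},P_0^{(k)},P_1^{(k)})$ (for $k=1$ there is no conditioning). Least favorable distributions (LFDs) $(Q_{0,k},Q_{1,k})$ of $(\mathcal{P}_{0,k},\mathcal{P}_{1,k})$: with $p_i^*$ the density of $P_i^*$ with respect to a common measure, they have densities $q_{0,k}=(1-\epsilon_{0,k})p_0^*$ where $p_1^*/p_0^*<c''$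 and $q_{0,k}=(1-\epsilon_{0,k})p_1^*/c''$ where $p_1^*/p_0^*\ge c''$; $q_{1,k}=(1-\epsilon_{1,k})p_1^*$ where $p_1^*/p_0^*>c'$ and $q_{1,k}=c'(1-\epsilon_{1,k})p_0^*$ where $p_1^*/p_0^*\le c'$, where $0\le c'<c''\le\infty$ (depending on $k$) are determined so that $q_{0,k},q_{1,k}$ are probability densities. $Q_i^{(k)}=Q_{i,1}\times\cdots\times Q_{i,k}$.
   Formalization: The optimal rules in (i) and (ii) are additionally assumed to decide alike, for each received bit, at observations with equal likelihood ratio of the least favorable densities; for an arbitrary minimizer the claim fails because of ties. *)

theory Defs
  imports "HOL-Probability.Probability"
begin

text \<open>
  Decisions \<open>U\<^sub>k \<in> {0, 1}\<close> are Booleans, with \<open>True\<close> for \<open>1\<close>. A sequence of decision rules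
  \<open>\<phi>\<close> sends an agent \<open>k \<ge> 1\<close>, its observation and the decision it receives to its own decision.
\<close>

type_synonym 'y rule = "'y \<Rightarrow> bool \<Rightarrow> bool"

definition decision_rule :: "'y measure \<Rightarrow> 'y rule \<Rightarrow> bool" where
  "decision_rule M r \<longleftrightarrow> (\<forall>u. (\<lambda>y. r y u) \<in> measurable M (count_space UNIV))"

definition decision_rules :: "'y measure \<Rightarrow> nat \<Rightarrow> (nat \<Rightarrow> 'y rule) \<Rightarrow> bool" where
  "decision_rules M N \<phi> \<longleftrightarrow> (\<forall>k\<in>{1..N}. decision_rule M (\<phi> k))"

fun decision :: "(nat \<Rightarrow> 'y rule) \<Rightarrow> nat \<Rightarrow> (nat \<Rightarrow> 'y) \<Rightarrow> bool" where
  "decision \<phi> 0 y = False"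
| "decision \<phi> (Suc k) y = \<phi> (Suc k) (y (Suc k)) (decision \<phi> k y)"

definition contamination_class :: "real \<Rightarrow> 'y measure \<Rightarrow> 'y measure set" where
  "contamination_class \<epsilon> Pst =
     {P. prob_space P \<and> sets P = sets Pst \<and>
         (\<exists>R. prob_space R \<and> sets R = sets Pst \<and>
              (\<forall>A\<in>sets Pst. measure P A = (1 - \<epsilon>) * measure Pst A + \<epsilon> * measure R A))}"

definition product_class :: "(nat \<Rightarrow> 'y measure set) \<Rightarrow> nat \<Rightarrow> (nat \<Rightarrow> 'y) measure set" where
  "product_class \<P> k = {PiM {1..k} P | P. \<forall>j\<in>{1..k}. P j \<in> \<P> j}"

text \<open>\<open>M\<^sub>0\<close> and \<open>M\<^sub>1\<close> are the joint laws of \<open>(Y\<^sub>1, \<dots>, Y\<^sub>k)\<close> under the two hypotheses.\<close>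

definition error_prob ::
  "real \<Rightarrow> real \<Rightarrow> nat \<Rightarrow> (nat \<Rightarrow> 'y rule) \<Rightarrow> (nat \<Rightarrow> 'y) measure \<Rightarrow> (nat \<Rightarrow> 'y) measure \<Rightarrow> real"
  where
  "error_prob \<pi>\<^sub>0 \<pi>\<^sub>1 k \<phi> M\<^sub>0 M\<^sub>1 =
     \<pi>\<^sub>0 * measure M\<^sub>0 {y\<in>space M\<^sub>0. decision \<phi> k y} +
     \<pi>\<^sub>1 * measure M\<^sub>1 {y\<in>space M\<^sub>1. \<not> decision \<phi> k y}"

definition DD_risk ::
  "real \<Rightarrow> real \<Rightarrow> (nat \<Rightarrow> 'y measure set) \<Rightarrow> (nat \<Rightarrow> 'y measure set) \<Rightarrow> nat \<Rightarrow> (nat \<Rightarrow> 'y rule) \<Rightarrow> real"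
  where
  "DD_risk \<pi>\<^sub>0 \<pi>\<^sub>1 \<P>\<^sub>0 \<P>\<^sub>1 N \<phi> =
     (SUP (M\<^sub>0, M\<^sub>1) \<in> product_class \<P>\<^sub>0 N \<times> product_class \<P>\<^sub>1 N. error_prob \<pi>\<^sub>0 \<pi>\<^sub>1 N \<phi> M\<^sub>0 M\<^sub>1)"

text \<open>
  In the social learning criterion only the entries \<open>1, \<dots>, k - 1\<close> of \<open>\<phi>\<close> matter: they are the
  rules of the preceding agents, and agent \<open>k\<close> uses the rule \<open>r\<close>.
\<close>

definition SL_risk ::
  "real \<Rightarrow> real \<Rightarrow> (nat \<Rightarrow> 'y measure set) \<Rightarrow> (nat \<Rightarrow> 'y measure set) \<Rightarrow> nat \<Rightarrow> (nat \<Rightarrow> 'y rule) \<Rightarrow>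
   'y rule \<Rightarrow> real"
  where
  "SL_risk \<pi>\<^sub>0 \<pi>\<^sub>1 \<P>\<^sub>0 \<P>\<^sub>1 k \<phi> r =
     (SUP (M\<^sub>0, M\<^sub>1) \<in> product_class \<P>\<^sub>0 k \<times> product_class \<P>\<^sub>1 k.
        error_prob \<pi>\<^sub>0 \<pi>\<^sub>1 k (\<phi>(k := r)) M\<^sub>0 M\<^sub>1)"

text \<open>
  Densities of the least favorable distributions, for nominal densities \<open>p\<^sub>0\<close>, \<open>p\<^sub>1\<close>. In
  \<^typ>\<open>ennreal\<close>, \<open>x / 0 = \<infinity>\<close> for \<open>x > 0\<close>, \<open>0 / 0 = 0\<close> and \<open>x / \<infinity> = 0\<close>, so that the case
  \<open>c\<^sub>h\<^sub>i = \<infinity>\<close> is covered.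
\<close>

definition lfd_density0 ::
  "real \<Rightarrow> ennreal \<Rightarrow> ('y \<Rightarrow> ennreal) \<Rightarrow> ('y \<Rightarrow> ennreal) \<Rightarrow> 'y \<Rightarrow> ennreal" where
  "lfd_density0 \<epsilon>\<^sub>0 c_hi p\<^sub>0 p\<^sub>1 y =
     (if p\<^sub>1 y / p\<^sub>0 y < c_hi then ennreal (1 - \<epsilon>\<^sub>0) * p\<^sub>0 y else ennreal (1 - \<epsilon>\<^sub>0) * p\<^sub>1 y / c_hi)"

definition lfd_density1 ::
  "real \<Rightarrow> ennreal \<Rightarrow> ('y \<Rightarrow> ennreal) \<Rightarrow> ('y \<Rightarrow> ennreal) \<Rightarrow> 'y \<Rightarrow> ennreal" where
  "lfd_density1 \<epsilon>\<^sub>1 c_lo p\<^sub>0 p\<^sub>1 y =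
     (if p\<^sub>1 y / p\<^sub>0 y > c_lo then ennreal (1 - \<epsilon>\<^sub>1) * p\<^sub>1 y else c_lo * ennreal (1 - \<epsilon>\<^sub>1) * p\<^sub>0 y)"

text \<open>
  A rule that takes the same decision at observations with equal likelihood ratio \<open>q\<^sub>1 / q\<^sub>0\<close>.
  Among the minimizers of the error probability under the least favorable distributions, this
  only fixes how ties are treated. Some such convention is needed: \<open>q\<^sub>1 / q\<^sub>0\<close> is constant on
  \<open>p\<^sub>1 / p\<^sub>0 \<le> c\<^sub>l\<^sub>o\<close> and on \<open>p\<^sub>1 / p\<^sub>0 \<ge> c\<^sub>h\<^sub>i\<close>, and if that constant is the optimal threshold, every
  way of splitting such a region is optimal under the least favorable distributions but need not
  be minimax over the uncertainty classes.
\<close>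

definition lr_based :: "'y measure \<Rightarrow> ('y \<Rightarrow> ennreal) \<Rightarrow> ('y \<Rightarrow> ennreal) \<Rightarrow> 'y rule \<Rightarrow> bool" where
  "lr_based M q\<^sub>0 q\<^sub>1 r \<longleftrightarrow>
     (\<forall>u. \<forall>y\<in>space M. \<forall>y'\<in>space M. q\<^sub>1 y / q\<^sub>0 y = q\<^sub>1 y' / q\<^sub>0 y' \<longrightarrow> r y u = r y' u)"

end

theory Submission
  imports Defs
begin

text \<open>
  An error probability under product laws is governed by a two-state Markov chain: the decision
  \<open>U\<^sub>k\<close> given \<open>U\<^bsub>k-1\<^esub> = u\<close> is \<open>1\<close> with the probability of
  \<open>{y. \<phi>\<^sub>k y u}\<close>. As a function of one such set \<open>S\<close>, the error under the least
  favorable distributions is \<open>A\<^sub>0 Q\<^sub>0(S) - A\<^sub>1 Q\<^sub>1(S)\<close> plus a constant, where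
  \<open>A\<^sub>i\<close> is the prior times the probability of receiving \<open>u\<close> times the influence
  \<open>d\<^sub>i\<close> of \<open>U\<^sub>k\<close> on the final decision. An optimal set is therefore a likelihood
  ratio test, in a direction given by the signs of \<open>A\<^sub>0\<close>, \<open>A\<^sub>1\<close>, and for such tests
  Huber's inequalities give \<open>d\<^sub>0 (P\<^sub>0(S) - Q\<^sub>0(S)) \<le> 0 \<le> d\<^sub>1 (P\<^sub>1(S) - Q\<^sub>1(S))\<close>.
  Exchanging the laws \<open>Q\<^bsub>i,k\<^esub>\<close> for \<open>P\<^bsub>i,k\<^esub>\<close> one agent at a time then never increases the
  error, so the least favorable laws attain the supremum.

  For social learning each agent optimizes its own error, so all tests have the positive direction,
  but the influence of \<open>U\<^sub>k\<close> on later decisions is no longer part of the optimization.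
  Inductively, either \<open>U\<^sub>k\<close> is deterministic or
  \<open>Q\<^sub>0(U\<^sub>k = 1) < Q\<^sub>1(U\<^sub>k = 1)\<close>; in the second case \<open>U\<^sub>k = 1\<close> strictly lowers
  the threshold of the next agent, which makes the chain monotone.
\<close>

subsection \<open>Contamination classes\<close>

text \<open>Signed combinations of two laws are compared later, which \<open>ennreal\<close> cannot
  express. Finite total mass makes the density real almost everywhere and the Bochner integral
  available.\<close>

lemma measure_density_eq_integral:
  assumes q: "q \<in> borel_measurable M" and fin: "(\<integral>\<^sup>+ y. q y \<partial>M) < \<infinity>" and A: "A \<in> sets M"
  shows "integrable M (\<lambda>y. indicator A y * enn2real (q y))"
    and "measure (density M q) A = (LINT y|M. indicator A y * enn2real (q y))"
proof -
  have ae: "AE y in M. q y < \<infinity>"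
    using nn_integral_PInf_AE[OF q] fin by (simp add: less_top)
  have eq: "(\<integral>\<^sup>+ y. ennreal (indicator A y * enn2real (q y)) \<partial>M) = (\<integral>\<^sup>+ y. q y * indicator A y \<partial>M)"
    by (intro nn_integral_cong_AE, use ae in eventually_elim) (auto split: split_indicator)
  have le: "(\<integral>\<^sup>+ y. q y * indicator A y \<partial>M) \<le> (\<integral>\<^sup>+ y. q y \<partial>M)"
    by (intro nn_integral_mono) (auto split: split_indicator)
  show "integrable M (\<lambda>y. indicator A y * enn2real (q y))"
  proof (rule integrableI_nonneg)
    show "(\<integral>\<^sup>+ y. ennreal (indicator A y * enn2real (q y)) \<partial>M) < \<infinity>"
      unfolding eq using le fin by (rule order.strict_trans1)
  qed (use q A in auto)
  show "measure (density M q) A = (LINT y|M. indicator A y * enn2real (q y))"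
  proof -
    have "(LINT y|M. indicator A y * enn2real (q y)) =
        enn2real (\<integral>\<^sup>+ y. ennreal (indicator A y * enn2real (q y)) \<partial>M)"
      using q A by (intro integral_eq_nn_integral) auto
    thus ?thesis
      unfolding eq using q A by (simp only: measure_def emeasure_density)
  qed
qed

lemma emeasure_density_space:
  assumes "p \<in> borel_measurable M"
  shows "emeasure (density M p) (space M) = (\<integral>\<^sup>+ y. p y \<partial>M)"
  using assms by (subst emeasure_density) (auto intro!: nn_integral_cong)

lemma nn_integral_density_prob:
  assumes "prob_space (density M p)" "p \<in> borel_measurable M"
  shows "(\<integral>\<^sup>+ y. p y \<partial>M) = 1"
  using prob_space.emeasure_space_1[OF assms(1)] emeasure_density_space[OF assms(2)] by simp

lemma prob_space_densityI:
  assumes "(\<integral>\<^sup>+ y. q y \<partial>M) = 1" "q \<in> borel_measurable M"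
  shows "prob_space (density M q)"
  by (intro prob_spaceI) (simp add: emeasure_density_space assms)

lemma contamination_classI:
  assumes "prob_space P" "sets P = sets Pst" "prob_space R" "sets R = sets Pst"
    and "\<And>A. A \<in> sets Pst \<Longrightarrow> measure P A = (1 - \<epsilon>) * measure Pst A + \<epsilon> * measure R A"
  shows "P \<in> contamination_class \<epsilon> Pst"
  unfolding contamination_class_def using assms by blast

lemma self_in_contamination_class:
  "prob_space P \<Longrightarrow> P \<in> contamination_class \<epsilon> P"
  by (rule contamination_classI[of _ _ P]) (simp_all add: algebra_simps)

lemma contamination_class_ge:
  assumes "P \<in> contamination_class \<epsilon> Pst" "A \<in> sets Pst" "0 \<le> \<epsilon>"
  shows "(1 - \<epsilon>) * measure Pst A \<le> measure P A"
proof -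
  from assms(1) obtain R where "measure P A = (1 - \<epsilon>) * measure Pst A + \<epsilon> * measure R A"
    unfolding contamination_class_def using assms(2) by blast
  thus ?thesis using assms(3) by simp
qed

text \<open>The contaminating law is the excess \<open>q - (1 - \<epsilon>) p\<close> divided by
  \<open>\<epsilon>\<close>: domination makes it nonnegative, and since \<open>p\<close> and
  \<open>q\<close> both have mass one, the excess has mass \<open>\<epsilon>\<close>.\<close>

lemma density_in_contamination_class:
  fixes p q :: "'y \<Rightarrow> ennreal"
  assumes [measurable]: "p \<in> borel_measurable M" "q \<in> borel_measurable M"
    and prob: "prob_space (density M p)" and q: "(\<integral>\<^sup>+ y. q y \<partial>M) = 1"
    and \<epsilon>: "0 \<le> \<epsilon>" "\<epsilon> < 1"
    and le: "AE y in M. ennreal (1 - \<epsilon>) * p y \<le> q y"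
  shows "density M q \<in> contamination_class \<epsilon> (density M p)"
proof -
  interpret P: prob_space "density M p" by (rule prob)
  interpret Q: prob_space "density M q" using prob_space_densityI[OF q] by simp
  have p: "(\<integral>\<^sup>+ y. p y \<partial>M) = 1" using nn_integral_density_prob[OF prob] by simp
  have em: "emeasure (density M q) A = ennreal (1 - \<epsilon>) * emeasure (density M p) A +
      (\<integral>\<^sup>+ y. (q y - ennreal (1 - \<epsilon>) * p y) * indicator A y \<partial>M)" if [measurable]: "A \<in> sets M" for A
  proof -
    have "emeasure (density M q) A = (\<integral>\<^sup>+ y. q y * indicator A y \<partial>M)"
      by (simp add: emeasure_density)
    also have "\<dots> = (\<integral>\<^sup>+ y. ennreal (1 - \<epsilon>) * (p y * indicator A y) +
        (q y - ennreal (1 - \<epsilon>) * p y) * indicator A y \<partial>M)"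
      by (intro nn_integral_cong_AE, use le in eventually_elim)
         (auto split: split_indicator simp: ennreal_diff_add_assoc add_diff_inverse_ennreal)
    also have "\<dots> = ennreal (1 - \<epsilon>) * emeasure (density M p) A +
      (\<integral>\<^sup>+ y. (q y - ennreal (1 - \<epsilon>) * p y) * indicator A y \<partial>M)"
      by (subst nn_integral_add) (auto simp: nn_integral_cmult emeasure_density)
    finally show ?thesis .
  qed
  have total: "1 = ennreal (1 - \<epsilon>) + (\<integral>\<^sup>+ y. q y - ennreal (1 - \<epsilon>) * p y \<partial>M)"
  proof -
    have "(\<integral>\<^sup>+ y. (q y - ennreal (1 - \<epsilon>) * p y) * indicator (space M) y \<partial>M) =
        (\<integral>\<^sup>+ y. q y - ennreal (1 - \<epsilon>) * p y \<partial>M)"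
      by (intro nn_integral_cong) simp
    thus ?thesis using em[of "space M"] p q by (simp add: emeasure_density_space)
  qed
  hence rest: "(\<integral>\<^sup>+ y. q y - ennreal (1 - \<epsilon>) * p y \<partial>M) = ennreal \<epsilon>"
  proof (cases "(\<integral>\<^sup>+ y. q y - ennreal (1 - \<epsilon>) * p y \<partial>M)")
    case (real r)
    thus ?thesis using total \<epsilon> by (simp flip: ennreal_plus)
  next
    case top
    thus ?thesis using total by simp
  qed
  \<comment> \<open>At \<open>\<epsilon> = 0\<close> the excess cannot be rescaled. It then has
    integral zero, both densities give the same measure, and the nominal law itself serves as
    contaminant.\<close>
  show ?thesis
  proof (cases "\<epsilon> = 0")
    case True
    have "AE y in M. q y - p y = 0"
    proof -
      have "(\<integral>\<^sup>+ y. q y - p y \<partial>M) = 0" using rest True by simp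
      thus ?thesis by (subst (asm) nn_integral_0_iff_AE) auto
    qed
    hence "measure (density M q) A = measure (density M p) A" if "A \<in> sets M" for A
    proof -
      have "(\<integral>\<^sup>+ y. (q y - ennreal (1 - \<epsilon>) * p y) * indicator A y \<partial>M) = 0"
        using \<open>AE y in M. q y - p y = 0\<close> True that by (subst nn_integral_0_iff_AE) auto
      thus ?thesis using em[OF that] True by (simp add: measure_def)
    qed
    thus ?thesis
      using True prob Q.prob_space_axioms by (intro contamination_classI[of _ _ "density M p"]) simp_all
  next
    case False
    define r where "r = (\<lambda>y. ennreal (1 / \<epsilon>) * (q y - ennreal (1 - \<epsilon>) * p y))"
    have [measurable]: "r \<in> borel_measurable M" unfolding r_def by measurable
    have "(\<integral>\<^sup>+ y. r y \<partial>M) = ennreal (1 / \<epsilon>) * ennreal \<epsilon>"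
      unfolding r_def by (subst nn_integral_cmult) (simp_all add: rest)
    also have "\<dots> = 1" using False \<epsilon> by (simp flip: ennreal_mult)
    finally have R: "prob_space (density M r)" by (intro prob_space_densityI) auto
    interpret R: prob_space "density M r" by (rule R)
    have "measure (density M q) A = (1 - \<epsilon>) * measure (density M p) A + \<epsilon> * measure (density M r) A"
      if [measurable]: "A \<in> sets M" for A
    proof -
      have "ennreal \<epsilon> * emeasure (density M r) A =
         (\<integral>\<^sup>+ y. ennreal \<epsilon> * (r y * indicator A y) \<partial>M)"
        by (simp add: emeasure_density nn_integral_cmult)
      also have "\<dots> = (\<integral>\<^sup>+ y. (q y - ennreal (1 - \<epsilon>) * p y) * indicator A y \<partial>M)"
        unfolding r_def using False \<epsilon>
        by (intro nn_integral_cong) (simp add: mult.assoc[symmetric] flip: ennreal_mult)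
      finally have "emeasure (density M q) A =
          ennreal (1 - \<epsilon>) * emeasure (density M p) A + ennreal \<epsilon> * emeasure (density M r) A"
        using em[OF that] by simp
      thus ?thesis
        using \<epsilon> by (simp add: P.emeasure_eq_measure Q.emeasure_eq_measure R.emeasure_eq_measure
            flip: ennreal_mult ennreal_plus)
    qed
    thus ?thesis
      using R Q.prob_space_axioms by (intro contamination_classI[of _ _ "density M r"]) simp_all
  qed
qed

lemma measure_density_cmult:
  assumes "p \<in> borel_measurable M" "q \<in> borel_measurable M" "A \<in> sets M" "0 \<le> c"
    and eq: "\<And>y. y \<in> A \<Longrightarrow> q y = ennreal c * p y"
  shows "measure (density M q) A = c * measure (density M p) A"
proof -
  have "emeasure (density M q) A = (\<integral>\<^sup>+ y. ennreal c * (p y * indicator A y) \<partial>M)"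
    using assms(1-3) by (subst emeasure_density) (auto intro!: nn_integral_cong simp: eq split: split_indicator)
  also have "\<dots> = ennreal c * emeasure (density M p) A"
    using assms(1-3) by (simp add: nn_integral_cmult emeasure_density)
  finally show ?thesis using assms(4) by (simp add: measure_def enn2real_mult)
qed

subsection \<open>Least favorable pairs\<close>

text \<open>One agent, with its index dropped. \<open>c_lo\<close> and \<open>c_hi\<close> are the
  clipping constants c' and c''; they enter through their order and the two normalizations at the
  end.\<close>

locale contaminated_pair =
  fixes M :: "'y measure" and p\<^sub>0 p\<^sub>1 :: "'y \<Rightarrow> ennreal" and \<epsilon>\<^sub>0 \<epsilon>\<^sub>1 :: real and c_lo c_hi :: ennreal
  assumes p_meas [measurable]: "p\<^sub>0 \<in> borel_measurable M" "p\<^sub>1 \<in> borel_measurable M"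
    and p_prob: "prob_space (density M p\<^sub>0)" "prob_space (density M p\<^sub>1)"
    and eps: "0 \<le> \<epsilon>\<^sub>0" "\<epsilon>\<^sub>0 < 1" "0 \<le> \<epsilon>\<^sub>1" "\<epsilon>\<^sub>1 < 1"
    and disjoint: "contamination_class \<epsilon>\<^sub>0 (density M p\<^sub>0) \<inter> contamination_class \<epsilon>\<^sub>1 (density M p\<^sub>1) = {}"
    and mutual_ac: "\<And>P P'.
      P \<in> contamination_class \<epsilon>\<^sub>0 (density M p\<^sub>0) \<union> contamination_class \<epsilon>\<^sub>1 (density M p\<^sub>1) \<Longrightarrow>
      P' \<in> contamination_class \<epsilon>\<^sub>0 (density M p\<^sub>0) \<union> contamination_class \<epsilon>\<^sub>1 (density M p\<^sub>1) \<Longrightarrow>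
      absolutely_continuous P P'"
    and c_less: "c_lo < c_hi"
    and q\<^sub>0_integral: "(\<integral>\<^sup>+ y. lfd_density0 \<epsilon>\<^sub>0 c_hi p\<^sub>0 p\<^sub>1 y \<partial>M) = 1"
    and q\<^sub>1_integral: "(\<integral>\<^sup>+ y. lfd_density1 \<epsilon>\<^sub>1 c_lo p\<^sub>0 p\<^sub>1 y \<partial>M) = 1"
begin

abbreviation "q\<^sub>0 \<equiv> lfd_density0 \<epsilon>\<^sub>0 c_hi p\<^sub>0 p\<^sub>1"
abbreviation "q\<^sub>1 \<equiv> lfd_density1 \<epsilon>\<^sub>1 c_lo p\<^sub>0 p\<^sub>1"
abbreviation "Q\<^sub>0 \<equiv> density M q\<^sub>0"
abbreviation "Q\<^sub>1 \<equiv> density M q\<^sub>1"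
abbreviation "\<P>\<^sub>0 \<equiv> contamination_class \<epsilon>\<^sub>0 (density M p\<^sub>0)"
abbreviation "\<P>\<^sub>1 \<equiv> contamination_class \<epsilon>\<^sub>1 (density M p\<^sub>1)"

lemma q_meas [measurable]: "q\<^sub>0 \<in> borel_measurable M" "q\<^sub>1 \<in> borel_measurable M"
  unfolding lfd_density0_def[abs_def] lfd_density1_def[abs_def] by measurable

lemma class_prob_space: "P \<in> \<P>\<^sub>0 \<union> \<P>\<^sub>1 \<Longrightarrow> prob_space P"
  and class_sets: "P \<in> \<P>\<^sub>0 \<union> \<P>\<^sub>1 \<Longrightarrow> sets P = sets M"
  by (auto simp: contamination_class_def)

lemma nominal_in_class: "density M p\<^sub>0 \<in> \<P>\<^sub>0" "density M p\<^sub>1 \<in> \<P>\<^sub>1"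
  using p_prob by (auto intro: self_in_contamination_class)

lemma nominal_finite: "AE y in M. p\<^sub>0 y \<noteq> \<infinity>" "AE y in M. p\<^sub>1 y \<noteq> \<infinity>"
  using nn_integral_density_prob[OF p_prob(1)] nn_integral_density_prob[OF p_prob(2)]
  by (intro nn_integral_PInf_AE; simp)+

lemma AE_class_iff:
  assumes "P \<in> \<P>\<^sub>0 \<union> \<P>\<^sub>1" "P' \<in> \<P>\<^sub>0 \<union> \<P>\<^sub>1"
  shows "(AE y in P. R y) \<longleftrightarrow> (AE y in P'. R y)"
proof
  have sets: "sets P = sets P'" using class_sets[OF assms(1)] class_sets[OF assms(2)] by simp
  show "AE y in P'. R y" if "AE y in P. R y"
    by (rule absolutely_continuous_AE[OF sets[symmetric] mutual_ac[OF assms] that])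
  show "AE y in P. R y" if "AE y in P'. R y"
    by (rule absolutely_continuous_AE[OF sets mutual_ac[OF assms(2,1)] that])
qed

text \<open>The contaminant is arbitrary, so a law in a class is not given by a density on
  \<open>M\<close>. A null set of \<open>M\<close> is null for the nominal law, and mutual absolute
  continuity carries this over.\<close>

lemma AE_in_class:
  assumes "P \<in> \<P>\<^sub>0 \<union> \<P>\<^sub>1" "AE y in M. R y"
  shows "AE y in P. R y"
proof -
  have "AE y in density M p\<^sub>0. R y" using assms(2) by (subst AE_density) auto
  thus ?thesis using AE_class_iff[OF assms(1), of "density M p\<^sub>0"] nominal_in_class by auto
qed

text \<open>It suffices that each density dominates its scaled nominal density. Where the ratio
  \<open>p\<^sub>1 / p\<^sub>0\<close> is clipped, this is the inequality defining that region,
  multiplied out.\<close>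

lemma lfd_in_class: "Q\<^sub>0 \<in> \<P>\<^sub>0" "Q\<^sub>1 \<in> \<P>\<^sub>1"
proof -
  have c: "c_hi \<noteq> 0" "c_lo \<noteq> \<infinity>" using c_less by auto
  show "Q\<^sub>0 \<in> \<P>\<^sub>0"
  proof (rule density_in_contamination_class)
    show "AE y in M. ennreal (1 - \<epsilon>\<^sub>0) * p\<^sub>0 y \<le> q\<^sub>0 y"
      using nominal_finite
    proof eventually_elim
      case (elim y)
      show ?case
      proof (cases "p\<^sub>1 y / p\<^sub>0 y < c_hi")
        case False
        hence h: "c_hi \<le> p\<^sub>1 y / p\<^sub>0 y" by simp
        have "p\<^sub>0 y \<le> p\<^sub>1 y / c_hi"
        \<comment> \<open>If \<open>c_hi\<close> is infinite, this branch means an infinite ratio,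
          and \<open>p\<^sub>0 y = 0\<close> because \<open>p\<^sub>1 y\<close> is finite.\<close>
        proof (cases "p\<^sub>0 y = 0 \<or> c_hi = \<infinity>")
          case True
          have "p\<^sub>0 y = 0" if "c_hi = \<infinity>"
            using h that elim by (metis ennreal_divide_eq_top_iff top.extremum_uniqueI infinity_ennreal_def)
          thus ?thesis using True by auto
        next
          case False
          thus ?thesis using h elim c
            by (cases "p\<^sub>0 y"; cases "p\<^sub>1 y"; cases c_hi)
               (auto simp: divide_ennreal field_simps)
        qed
        hence "ennreal (1 - \<epsilon>\<^sub>0) * p\<^sub>0 y \<le> ennreal (1 - \<epsilon>\<^sub>0) * (p\<^sub>1 y / c_hi)"
          by (rule mult_left_mono) simp
        thus ?thesis using False by (simp add: lfd_density0_def ennreal_times_divide)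
      qed (simp add: lfd_density0_def)
    qed
  qed (use p_prob q\<^sub>0_integral eps in auto)
  show "Q\<^sub>1 \<in> \<P>\<^sub>1"
  proof (rule density_in_contamination_class)
    show "AE y in M. ennreal (1 - \<epsilon>\<^sub>1) * p\<^sub>1 y \<le> q\<^sub>1 y"
      using nominal_finite
    proof eventually_elim
      case (elim y)
      show ?case
      proof (cases "p\<^sub>1 y / p\<^sub>0 y > c_lo")
        case False
        hence h: "p\<^sub>1 y / p\<^sub>0 y \<le> c_lo" by simp
        have "p\<^sub>1 y \<le> c_lo * p\<^sub>0 y"
        proof (cases "p\<^sub>0 y = 0")
          case True
          hence "p\<^sub>1 y = 0"
            using h c by (metis ennreal_divide_eq_top_iff top.extremum_uniqueI infinity_ennreal_def)
          thus ?thesis by simp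
        next
          case False
          thus ?thesis using h elim c
            by (cases "p\<^sub>0 y"; cases "p\<^sub>1 y"; cases c_lo)
               (auto simp: divide_ennreal field_simps simp flip: ennreal_mult)
        qed
        hence "ennreal (1 - \<epsilon>\<^sub>1) * p\<^sub>1 y \<le> ennreal (1 - \<epsilon>\<^sub>1) * (c_lo * p\<^sub>0 y)"
          by (rule mult_left_mono) simp
        thus ?thesis using False by (simp add: lfd_density1_def mult_ac)
      qed (simp add: lfd_density1_def)
    qed
  qed (use p_prob q\<^sub>1_integral eps in auto)
qed

section \<open>The clipped likelihood ratio and Huber's dominance inequalities\<close>

definition regular :: "'y \<Rightarrow> bool" where
  "regular y \<longleftrightarrow> p\<^sub>0 y \<noteq> 0 \<and> p\<^sub>0 y \<noteq> \<infinity> \<and> p\<^sub>1 y \<noteq> 0 \<and> p\<^sub>1 y \<noteq> \<infinity>"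

text \<open>Each nominal density is nonzero almost everywhere under its own law; equality of null
  sets extends this to all laws in both classes.\<close>

lemma AE_regular:
  assumes "P \<in> \<P>\<^sub>0 \<union> \<P>\<^sub>1"
  shows "AE y in P. regular y"
proof -
  have "AE y in density M p\<^sub>0. p\<^sub>0 y \<noteq> 0" "AE y in density M p\<^sub>1. p\<^sub>1 y \<noteq> 0"
    using AE_density[OF p_meas(1), of "\<lambda>y. p\<^sub>0 y \<noteq> 0"] AE_density[OF p_meas(2), of "\<lambda>y. p\<^sub>1 y \<noteq> 0"]
    by (auto simp: less_imp_neq[symmetric])
  hence "AE y in P. p\<^sub>0 y \<noteq> 0" "AE y in P. p\<^sub>1 y \<noteq> 0"
    using AE_class_iff[OF assms] nominal_in_class by (meson UnI1 UnI2)+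
  thus ?thesis
    using AE_in_class[OF assms nominal_finite(1)] AE_in_class[OF assms nominal_finite(2)]
    by eventually_elim (auto simp: regular_def)
qed

lemma regular_lfd_finite:
  assumes "regular y"
  shows "q\<^sub>0 y \<noteq> 0" "q\<^sub>0 y \<noteq> \<infinity>" "q\<^sub>1 y \<noteq> 0" "q\<^sub>1 y \<noteq> \<infinity>"
proof -
  obtain a b where ab: "p\<^sub>0 y = ennreal a" "p\<^sub>1 y = ennreal b" "0 < a" "0 < b"
    using assms by (cases "p\<^sub>0 y"; cases "p\<^sub>1 y") (auto simp: regular_def less_le)
  have e: "ennreal (1 - \<epsilon>\<^sub>0) \<noteq> 0" "ennreal (1 - \<epsilon>\<^sub>1) \<noteq> 0" using eps by auto
  have L: "p\<^sub>1 y / p\<^sub>0 y = ennreal (b / a)" using ab by (simp add: divide_ennreal)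
  have pos: "ennreal a \<noteq> 0" "ennreal b \<noteq> 0" using ab by auto
  have hi: "c_hi \<noteq> 0" "c_hi \<noteq> top" if "\<not> ennreal (b / a) < c_hi"
    using that c_less by (auto simp: top.not_eq_extremum[symmetric])
  have lo: "c_lo \<noteq> 0" "c_lo \<noteq> top" if "\<not> c_lo < ennreal (b / a)"
    using that c_less ab by (auto simp: less_top[symmetric])
  show "q\<^sub>0 y \<noteq> 0" "q\<^sub>0 y \<noteq> \<infinity>"
    using e pos hi unfolding lfd_density0_def L unfolding ab
    by (cases "ennreal (b / a) < c_hi"; simp add: ennreal_divide_eq_top_iff ennreal_mult_eq_top_iff)+
  show "q\<^sub>1 y \<noteq> 0" "q\<^sub>1 y \<noteq> \<infinity>"
    using e pos lo unfolding lfd_density1_def L unfolding ab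
    by (cases "c_lo < ennreal (b / a)"; simp add: ennreal_divide_eq_top_iff ennreal_mult_eq_top_iff)+
qed

text \<open>Huber's clipped ratio. For a nominal ratio below \<open>c_lo\<close> the factor
  \<open>p\<^sub>0 y\<close> cancels, above \<open>c_hi\<close> the factor
  \<open>p\<^sub>1 y\<close> cancels, and in between the nominal ratio survives.\<close>

lemma regular_lr:
  assumes "regular y"
  shows "q\<^sub>1 y / q\<^sub>0 y = ennreal ((1 - \<epsilon>\<^sub>1) / (1 - \<epsilon>\<^sub>0)) * max c_lo (min c_hi (p\<^sub>1 y / p\<^sub>0 y))"
proof -
  obtain a b where ab: "p\<^sub>0 y = ennreal a" "p\<^sub>1 y = ennreal b" "0 < a" "0 < b"
    using assms by (cases "p\<^sub>0 y"; cases "p\<^sub>1 y") (auto simp: regular_def less_le)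
  obtain l where l: "c_lo = ennreal l" "0 \<le> l" using c_less by (cases c_lo) auto
  have e: "0 < 1 - \<epsilon>\<^sub>0" "0 < 1 - \<epsilon>\<^sub>1" using eps by auto
  show ?thesis
  proof (cases c_hi)
    case (real h)
    have lh: "l < h" using c_less real l by (simp add: ennreal_less_iff)
    consider "b / a \<le> l" | "l < b / a" "b / a < h" | "h \<le> b / a" by linarith
    thus ?thesis
    proof cases
      case 1
      hence "b / a < h" using lh by simp
      moreover have "0 < l" using 1 ab by (meson divide_pos_pos less_le_trans)
      ultimately show ?thesis using 1 ab l real e lh
        by (simp add: lfd_density0_def lfd_density1_def divide_ennreal ennreal_less_iff
           min_def max_def field_simps not_less flip: ennreal_mult)
    next
      case 2
      thus ?thesis using ab l real e lh
        by (simp add: lfd_density0_def lfd_density1_def divide_ennreal ennreal_less_iff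
           min_def max_def field_simps not_less flip: ennreal_mult)
    next
      case 3
      moreover have "\<not> b / a \<le> l" using 3 lh by linarith
      ultimately show ?thesis using ab l real e lh
        by (simp add: lfd_density0_def lfd_density1_def divide_ennreal ennreal_less_iff
           min_def max_def field_simps not_less flip: ennreal_mult)
    qed
  next
    case top
    hence min: "min c_hi z = z" for z by (simp add: min_def top.extremum_unique)
    have "p\<^sub>1 y / p\<^sub>0 y < c_hi" using ab top by (simp add: divide_ennreal)
    moreover have "(c_lo < p\<^sub>1 y / p\<^sub>0 y) = (l < b / a)"
      using ab l by (simp add: divide_ennreal ennreal_less_iff)
    ultimately show ?thesis
    proof (cases "b / a \<le> l")
      case True
      have "ennreal l * ennreal (1 - \<epsilon>\<^sub>1) * ennreal a = ennreal (l * (1 - \<epsilon>\<^sub>1) * a)"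
        using l e ab by (simp add: ennreal_mult)
      moreover have "ennreal (1 - \<epsilon>\<^sub>0) * ennreal a = ennreal ((1 - \<epsilon>\<^sub>0) * a)"
        using e ab by (simp add: ennreal_mult)
      ultimately have "q\<^sub>1 y / q\<^sub>0 y = ennreal (l * (1 - \<epsilon>\<^sub>1) * a / ((1 - \<epsilon>\<^sub>0) * a))"
        using True \<open>p\<^sub>1 y / p\<^sub>0 y < c_hi\<close> \<open>(c_lo < p\<^sub>1 y / p\<^sub>0 y) = (l < b / a)\<close> ab l e
        by (simp add: lfd_density0_def lfd_density1_def divide_ennreal)
      also have "l * (1 - \<epsilon>\<^sub>1) * a / ((1 - \<epsilon>\<^sub>0) * a) = (1 - \<epsilon>\<^sub>1) / (1 - \<epsilon>\<^sub>0) * l"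
        using ab by simp
      also have "ennreal \<dots> = ennreal ((1 - \<epsilon>\<^sub>1) / (1 - \<epsilon>\<^sub>0)) * c_lo"
        unfolding l by (intro ennreal_mult) (use l e in auto)
      finally show ?thesis
        using True ab l unfolding min by (simp add: divide_ennreal max_def)
    next
      case False
      thus ?thesis using ab l e \<open>p\<^sub>1 y / p\<^sub>0 y < c_hi\<close> unfolding min
        by (simp add: lfd_density0_def lfd_density1_def divide_ennreal ennreal_less_iff
           max_def field_simps not_less flip: ennreal_mult')
    qed
  qed
qed

text \<open>Likelihood ratio tests without a named threshold, strict or not. The set
  \<open>G\<close> discards a null set, because optimality determines a test only almost
  everywhere.\<close>

definition lr_upper :: "'y set \<Rightarrow> bool" where
  "lr_upper S \<longleftrightarrow> (\<exists>G\<in>sets M. (AE y in density M p\<^sub>0. y \<in> G) \<and>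
     (\<forall>y\<in>G. \<forall>y'\<in>G. y \<in> S \<longrightarrow> q\<^sub>1 y / q\<^sub>0 y \<le> q\<^sub>1 y' / q\<^sub>0 y' \<longrightarrow> y' \<in> S))"

lemma class_measure_compl:
  assumes "P \<in> \<P>\<^sub>0 \<union> \<P>\<^sub>1" "S \<in> sets M"
  shows "measure P (space M - S) = 1 - measure P S"
proof -
  interpret prob_space P using class_prob_space[OF assms(1)] .
  show ?thesis
    using prob_compl[of S] assms(2) class_sets[OF assms(1)] sets_eq_imp_space_eq[OF class_sets[OF assms(1)]]
    by simp
qed

lemma class_measure_0_iff:
  assumes "P \<in> \<P>\<^sub>0 \<union> \<P>\<^sub>1" "P' \<in> \<P>\<^sub>0 \<union> \<P>\<^sub>1" "S \<in> sets M"
  shows "measure P S = 0 \<longleftrightarrow> measure P' S = 0"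
  using AE_class_iff[OF assms(1,2), of "\<lambda>y. y \<notin> S"] assms class_sets
    prob_space.prob_eq_0[OF class_prob_space[OF assms(1)], of S]
    prob_space.prob_eq_0[OF class_prob_space[OF assms(2)], of S] by simp

lemma class_measure_1_iff:
  assumes "P \<in> \<P>\<^sub>0 \<union> \<P>\<^sub>1" "P' \<in> \<P>\<^sub>0 \<union> \<P>\<^sub>1" "S \<in> sets M"
  shows "measure P S = 1 \<longleftrightarrow> measure P' S = 1"
  using class_measure_0_iff[OF assms(1,2), of "space M - S"] assms(3)
  by (simp add: class_measure_compl[OF assms(1,3)] class_measure_compl[OF assms(2,3)])

text \<open>If \<open>S\<close> misses a point of \<open>G\<close> clipped at \<open>c_hi\<close>,
  it misses all of \<open>G\<close>, since that point has the largest ratio. Otherwise its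
  complement lies in \<open>G\<close> where \<open>q\<^sub>0\<close> is the scaled nominal density,
  which is a lower bound for every law in the class. The second inequality is dual, with points
  clipped at \<open>c_lo\<close> and \<open>S\<close> itself in place of its complement.\<close>

lemma lr_upper_dominance:
  assumes S [measurable]: "S \<in> sets M" and upper: "lr_upper S" and P: "P\<^sub>0 \<in> \<P>\<^sub>0" "P\<^sub>1 \<in> \<P>\<^sub>1"
  shows "measure P\<^sub>0 S \<le> measure Q\<^sub>0 S" "measure Q\<^sub>1 S \<le> measure P\<^sub>1 S"
proof -
  obtain G\<^sub>0 where G\<^sub>0 [measurable]: "G\<^sub>0 \<in> sets M" and ae: "AE y in density M p\<^sub>0. y \<in> G\<^sub>0"
    and up: "\<And>y y'. y \<in> G\<^sub>0 \<Longrightarrow> y' \<in> G\<^sub>0 \<Longrightarrow> y \<in> S \<Longrightarrow> q\<^sub>1 y / q\<^sub>0 y \<le> q\<^sub>1 y' / q\<^sub>0 y' \<Longrightarrow> y' \<in> S"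
    using upper unfolding lr_upper_def by blast
  define G where "G = {y \<in> space M. y \<in> G\<^sub>0 \<and> regular y}"
  have G [measurable]: "G \<in> sets M" unfolding G_def regular_def by measurable
  let ?L = "\<lambda>y. p\<^sub>1 y / p\<^sub>0 y"
  have AE_G: "AE y in P. y \<in> G" if "P \<in> \<P>\<^sub>0 \<union> \<P>\<^sub>1" for P
    using AE_class_iff[OF that, of "density M p\<^sub>0" "\<lambda>y. y \<in> G\<^sub>0"] ae nominal_in_class
      AE_regular[OF that] AE_space[of P] sets_eq_imp_space_eq[OF class_sets[OF that]]
    by (auto simp: G_def)
  have meas_G: "measure P (A \<inter> G) = measure P A" if "P \<in> \<P>\<^sub>0 \<union> \<P>\<^sub>1" "A \<in> sets M" for P A
    using AE_G[OF that(1)] that(2) G class_sets[OF that(1)]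
    by (intro measure_eq_AE) auto
  \<comment> \<open>Points clipped at \<open>c_hi\<close> have the largest likelihood ratio in
    \<open>G\<close>, points clipped at \<open>c_lo\<close> the smallest.\<close>
  have le: "q\<^sub>1 y / q\<^sub>0 y \<le> q\<^sub>1 y' / q\<^sub>0 y'" if "y \<in> G" "y' \<in> G" "c_hi \<le> ?L y' \<or> ?L y \<le> c_lo" for y y'
  proof -
    have "max c_lo (min c_hi (?L y)) \<le> max c_lo (min c_hi (?L y'))"
      using that(3) by (auto simp: max_def min_def)
    thus ?thesis using that(1,2) by (simp add: G_def regular_lr mult_left_mono)
  qed
  have *: "P\<^sub>0 \<in> \<P>\<^sub>0 \<union> \<P>\<^sub>1" "P\<^sub>1 \<in> \<P>\<^sub>0 \<union> \<P>\<^sub>1" "Q\<^sub>0 \<in> \<P>\<^sub>0 \<union> \<P>\<^sub>1" "Q\<^sub>1 \<in> \<P>\<^sub>0 \<union> \<P>\<^sub>1"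
    using P lfd_in_class by auto
  show "measure P\<^sub>0 S \<le> measure Q\<^sub>0 S"
  proof (cases "\<exists>y\<in>G. c_hi \<le> ?L y \<and> y \<notin> S")
    case True
    then obtain y where y: "y \<in> G" "c_hi \<le> ?L y" "y \<notin> S" by blast
    hence "S \<inter> G = {}" using up le by (auto simp: G_def)
    hence "measure P\<^sub>0 S = 0" using meas_G[OF *(1) S] by simp
    thus ?thesis by simp
  next
    case False
    have "measure Q\<^sub>0 (space M - S) = measure Q\<^sub>0 ((space M - S) \<inter> G)"
      using meas_G[OF *(3), of "space M - S"] by simp
    also have "\<dots> = (1 - \<epsilon>\<^sub>0) * measure (density M p\<^sub>0) ((space M - S) \<inter> G)"
      using False eps by (intro measure_density_cmult) (auto simp: lfd_density0_def not_le)
    also have "\<dots> \<le> measure P\<^sub>0 ((space M - S) \<inter> G)"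
      using P eps by (intro contamination_class_ge) auto
    also have "\<dots> = measure P\<^sub>0 (space M - S)"
      using meas_G[OF *(1), of "space M - S"] by simp
    finally show ?thesis by (simp add: class_measure_compl[OF *(1)] class_measure_compl[OF *(3)])
  qed
  show "measure Q\<^sub>1 S \<le> measure P\<^sub>1 S"
  proof (cases "\<exists>y\<in>G. ?L y \<le> c_lo \<and> y \<in> S")
    case True
    then obtain y where y: "y \<in> G" "?L y \<le> c_lo" "y \<in> S" by blast
    hence "(space M - S) \<inter> G = {}" using up le by (auto simp: G_def)
    hence "measure P\<^sub>1 (space M - S) = 0" using meas_G[OF *(2), of "space M - S"] by simp
    hence "measure P\<^sub>1 S = 1" by (simp add: class_measure_compl[OF *(2)])
    thus ?thesis using prob_space.prob_le_1[OF class_prob_space[OF *(4)]] by simp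
  next
    case False
    have "measure Q\<^sub>1 S = measure Q\<^sub>1 (S \<inter> G)"
      using meas_G[OF *(4)] by simp
    also have "\<dots> = (1 - \<epsilon>\<^sub>1) * measure (density M p\<^sub>1) (S \<inter> G)"
      using False eps by (intro measure_density_cmult) (auto simp: lfd_density1_def not_le)
    also have "\<dots> \<le> measure P\<^sub>1 (S \<inter> G)"
      using P eps by (intro contamination_class_ge) auto
    also have "\<dots> = measure P\<^sub>1 S"
      using meas_G[OF *(2)] by simp
    finally show ?thesis .
  qed
qed

section \<open>Bayes-optimal sets and the saddle point of one agent\<close>

definition bayes_optimal :: "real \<Rightarrow> real \<Rightarrow> 'y set \<Rightarrow> bool" where
  "bayes_optimal A\<^sub>0 A\<^sub>1 S \<longleftrightarrow> S \<in> sets M \<and>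
     (\<forall>S'\<in>sets M. A\<^sub>0 * measure Q\<^sub>0 S - A\<^sub>1 * measure Q\<^sub>1 S \<le> A\<^sub>0 * measure Q\<^sub>0 S' - A\<^sub>1 * measure Q\<^sub>1 S')"

text \<open>The tie convention \<open>lr_based\<close>, expressed for the set of observations at
  which a rule decides 1.\<close>

definition lr_invariant :: "'y set \<Rightarrow> bool" where
  "lr_invariant S \<longleftrightarrow> (\<forall>y\<in>space M. \<forall>y'\<in>space M. q\<^sub>1 y / q\<^sub>0 y = q\<^sub>1 y' / q\<^sub>0 y' \<longrightarrow> (y \<in> S \<longleftrightarrow> y' \<in> S))"

text \<open>Coefficients are negative when deciding 1 makes a final 1 less likely. Passing to the
  complement exchanges the roles of the two decisions and reverses both signs.\<close>

lemma bayes_optimal_compl: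
  assumes "bayes_optimal A\<^sub>0 A\<^sub>1 S"
  shows "bayes_optimal (- A\<^sub>0) (- A\<^sub>1) (space M - S)"
proof -
  have S: "S \<in> sets M" using assms by (simp add: bayes_optimal_def)
  have *: "Q\<^sub>0 \<in> \<P>\<^sub>0 \<union> \<P>\<^sub>1" "Q\<^sub>1 \<in> \<P>\<^sub>0 \<union> \<P>\<^sub>1" using lfd_in_class by auto
  have "A\<^sub>0 * measure Q\<^sub>0 S - A\<^sub>1 * measure Q\<^sub>1 S \<le>
      A\<^sub>0 * measure Q\<^sub>0 (space M - S') - A\<^sub>1 * measure Q\<^sub>1 (space M - S')" if "S' \<in> sets M" for S'
    using assms that by (auto simp: bayes_optimal_def)
  thus ?thesis
    using S by (auto simp: bayes_optimal_def class_measure_compl[OF *(1)] class_measure_compl[OF *(2)] algebra_simps)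
qed

text \<open>The Neyman-Pearson argument: an optimal set can disagree with the sign of the integrand
  \<open>h\<close> only on a null set.\<close>

lemma bayes_optimal_AE:
  assumes "bayes_optimal A\<^sub>0 A\<^sub>1 S"
  shows "AE y in M. (A\<^sub>0 * enn2real (q\<^sub>0 y) < A\<^sub>1 * enn2real (q\<^sub>1 y) \<longrightarrow> y \<in> S) \<and>
    (A\<^sub>1 * enn2real (q\<^sub>1 y) < A\<^sub>0 * enn2real (q\<^sub>0 y) \<longrightarrow> y \<notin> S)"
proof -
  define h where "h y = A\<^sub>0 * enn2real (q\<^sub>0 y) - A\<^sub>1 * enn2real (q\<^sub>1 y)" for y
  have [measurable]: "h \<in> borel_measurable M" unfolding h_def by measurable
  have S [measurable]: "S \<in> sets M" using assms by (simp add: bayes_optimal_def)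
  \<comment> \<open>The competitor copies \<open>S\<close> where \<open>h\<close> vanishes. The
    integrand \<open>k\<close> of the difference is then nonnegative, and it vanishes exactly where
    \<open>S\<close> follows the sign of \<open>h\<close>.\<close>
  define S' where "S' = {y \<in> space M. h y < 0 \<or> (h y = 0 \<and> y \<in> S)}"
  have S' [measurable]: "S' \<in> sets M" unfolding S'_def by measurable
  have fin: "(\<integral>\<^sup>+ y. q\<^sub>0 y \<partial>M) < \<infinity>" "(\<integral>\<^sup>+ y. q\<^sub>1 y \<partial>M) < \<infinity>"
    using q\<^sub>0_integral q\<^sub>1_integral by auto
  have int: "integrable M (\<lambda>y. indicator A y * h y)"
    and val: "(LINT y|M. indicator A y * h y) = A\<^sub>0 * measure Q\<^sub>0 A - A\<^sub>1 * measure Q\<^sub>1 A"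
    if A: "A \<in> sets M" for A
  proof -
    note i0 = measure_density_eq_integral[OF q_meas(1) fin(1) A]
    note i1 = measure_density_eq_integral[OF q_meas(2) fin(2) A]
    have eq: "(\<lambda>y. indicator A y * h y) =
      (\<lambda>y. A\<^sub>0 * (indicator A y * enn2real (q\<^sub>0 y)) - A\<^sub>1 * (indicator A y * enn2real (q\<^sub>1 y)))"
      by (auto simp: h_def algebra_simps)
    show "integrable M (\<lambda>y. indicator A y * h y)"
      unfolding eq using i0(1) i1(1) by (intro Bochner_Integration.integrable_diff integrable_mult_right)
    show "(LINT y|M. indicator A y * h y) = A\<^sub>0 * measure Q\<^sub>0 A - A\<^sub>1 * measure Q\<^sub>1 A"
      unfolding eq i0(2) i1(2) using i0(1) i1(1)
      by (subst Bochner_Integration.integral_diff) (simp_all only: integrable_mult_right integral_mult_right_zero)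
  qed
  define k where "k y = indicator S y * h y - indicator S' y * h y" for y
  have k_int: "integrable M k"
    unfolding k_def using int[OF S] int[OF S'] by (rule Bochner_Integration.integrable_diff)
  have k_nonneg: "0 \<le> k y" if "y \<in> space M" for y
    using that by (auto simp: k_def S'_def indicator_def)
  have "(LINT y|M. k y) = (A\<^sub>0 * measure Q\<^sub>0 S - A\<^sub>1 * measure Q\<^sub>1 S) - (A\<^sub>0 * measure Q\<^sub>0 S' - A\<^sub>1 * measure Q\<^sub>1 S')"
    unfolding k_def using int[OF S] int[OF S'] by (simp only: Bochner_Integration.integral_diff val[OF S] val[OF S'])
  also have "\<dots> \<le> 0" using assms S' by (simp add: bayes_optimal_def)
  finally have "(LINT y|M. k y) = 0"
    using k_nonneg by (intro antisym) (auto intro: Bochner_Integration.integral_nonneg)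
  hence "AE y in M. k y = 0"
    using k_int k_nonneg by (subst (asm) integral_nonneg_eq_0_iff_AE) auto
  thus ?thesis
    using AE_space
  proof eventually_elim
    case (elim y)
    thus ?case by (auto simp: k_def S'_def indicator_def h_def split: if_splits)
  qed
qed

text \<open>Almost everywhere, membership compares the likelihood ratio with a threshold, and
  \<open>lr_invariant\<close> settles ties. A positive coefficient fixes the direction of the test;
  with both coefficients zero every measurable set is optimal.\<close>

lemma bayes_optimal_lr_upper:
  assumes opt: "bayes_optimal A\<^sub>0 A\<^sub>1 S" and inv: "lr_invariant S" and pos: "0 < A\<^sub>0 \<or> 0 < A\<^sub>1"
  shows "lr_upper S"
proof -
  have S [measurable]: "S \<in> sets M" using opt by (simp add: bayes_optimal_def)
  let ?f = "\<lambda>y. enn2real (q\<^sub>0 y)" and ?g = "\<lambda>y. enn2real (q\<^sub>1 y)"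
  let ?R = "\<lambda>y. (A\<^sub>0 * ?f y < A\<^sub>1 * ?g y \<longrightarrow> y \<in> S) \<and> (A\<^sub>1 * ?g y < A\<^sub>0 * ?f y \<longrightarrow> y \<notin> S)"
  define G where "G = {y \<in> space M. regular y \<and> ?R y}"
  have "G \<in> sets M" unfolding G_def regular_def by measurable
  moreover have "AE y in density M p\<^sub>0. y \<in> G"
  proof -
    have n: "density M p\<^sub>0 \<in> \<P>\<^sub>0 \<union> \<P>\<^sub>1" using nominal_in_class by auto
    show ?thesis
      using AE_in_class[OF n bayes_optimal_AE[OF opt]] AE_regular[OF n] AE_space
      by eventually_elim (auto simp: G_def)
  qed
  moreover have "y' \<in> S" if y: "y \<in> G" "y' \<in> G" "y \<in> S" and le: "q\<^sub>1 y / q\<^sub>0 y \<le> q\<^sub>1 y' / q\<^sub>0 y'" for y y'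
  proof -
    have pos_fg: "0 < ?f z" "0 < ?g z" and fg: "ennreal (?f z) = q\<^sub>0 z" "ennreal (?g z) = q\<^sub>1 z"
      if "z \<in> G" for z
    proof -
      have "regular z" using that by (simp add: G_def)
      from regular_lfd_finite[OF this]
      show "0 < ?f z" "0 < ?g z" "ennreal (?f z) = q\<^sub>0 z" "ennreal (?g z) = q\<^sub>1 z"
        by (simp_all add: enn2real_positive_iff less_top[symmetric] zero_less_iff_neq_zero)
    qed
    have lr: "q\<^sub>1 z / q\<^sub>0 z = ennreal (?g z / ?f z)" if "z \<in> G" for z
      using divide_ennreal[of "?g z" "?f z"] pos_fg[OF that] by (simp add: fg[OF that])
    have le': "?g y / ?f y \<le> ?g y' / ?f y'"
      using le pos_fg[OF y(1)] pos_fg[OF y(2)] by (simp add: lr[OF y(1)] lr[OF y(2)])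
    have "\<not> A\<^sub>1 * ?g y < A\<^sub>0 * ?f y" using y by (auto simp: G_def)
    hence A: "A\<^sub>0 \<le> A\<^sub>1 * (?g y / ?f y)"
      using pos_fg[OF y(1)] by (simp add: field_simps not_less)
    \<comment> \<open>A point of \<open>S\<close> in \<open>G\<close> gives the bound
      \<open>A\<close>, which for \<open>A\<^sub>1 \<le> 0\<close> would make both coefficients
      nonpositive.\<close>
    have pos1: "0 < A\<^sub>1"
    proof (rule ccontr)
      assume "\<not> 0 < A\<^sub>1"
      hence "A\<^sub>1 * (?g y / ?f y) \<le> 0" by (intro mult_nonpos_nonneg) auto
      thus False using A pos \<open>\<not> 0 < A\<^sub>1\<close> by linarith
    qed
    show ?thesis
    proof (cases "?g y / ?f y = ?g y' / ?f y'")
      case True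
      hence "q\<^sub>1 y / q\<^sub>0 y = q\<^sub>1 y' / q\<^sub>0 y'" by (simp only: lr[OF y(1)] lr[OF y(2)])
      thus ?thesis using inv y by (auto simp: lr_invariant_def G_def)
    next
      case False
      hence "A\<^sub>1 * (?g y / ?f y) < A\<^sub>1 * (?g y' / ?f y')"
        using le' pos1 by (intro mult_strict_left_mono) auto
      hence "A\<^sub>0 < A\<^sub>1 * (?g y' / ?f y')" using A by linarith
      hence "A\<^sub>0 * ?f y' < A\<^sub>1 * ?g y'" using pos_fg[OF y(2)] by (simp add: field_simps)
      thus ?thesis using y(2) by (simp add: G_def)
    qed
  qed
  ultimately show ?thesis unfolding lr_upper_def by blast
qed

lemma lr_invariant_compl: "lr_invariant S \<Longrightarrow> lr_invariant (space M - S)"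
  unfolding lr_invariant_def by blast

text \<open>A positive coefficient makes \<open>S\<close> an upper set, a negative one its
  complement. Multiplying by the coefficient absorbs the reversal of the dominance inequality, and
  for a zero coefficient the claim is trivial.\<close>

lemma bayes_optimal_saddle:
  assumes opt: "bayes_optimal A\<^sub>0 A\<^sub>1 S" and inv: "lr_invariant S" and P: "P\<^sub>0 \<in> \<P>\<^sub>0" "P\<^sub>1 \<in> \<P>\<^sub>1"
  shows "A\<^sub>0 * measure P\<^sub>0 S \<le> A\<^sub>0 * measure Q\<^sub>0 S" "A\<^sub>1 * measure Q\<^sub>1 S \<le> A\<^sub>1 * measure P\<^sub>1 S"
proof -
  have S: "S \<in> sets M" using opt by (simp add: bayes_optimal_def)
  have *: "P\<^sub>0 \<in> \<P>\<^sub>0 \<union> \<P>\<^sub>1" "P\<^sub>1 \<in> \<P>\<^sub>0 \<union> \<P>\<^sub>1" "Q\<^sub>0 \<in> \<P>\<^sub>0 \<union> \<P>\<^sub>1" "Q\<^sub>1 \<in> \<P>\<^sub>0 \<union> \<P>\<^sub>1"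
    using P lfd_in_class by auto
  have pos: "measure P\<^sub>0 S \<le> measure Q\<^sub>0 S" "measure Q\<^sub>1 S \<le> measure P\<^sub>1 S" if "0 < A\<^sub>0 \<or> 0 < A\<^sub>1"
    using lr_upper_dominance[OF S bayes_optimal_lr_upper[OF opt inv that] P] by auto
  have neg: "measure Q\<^sub>0 S \<le> measure P\<^sub>0 S" "measure P\<^sub>1 S \<le> measure Q\<^sub>1 S" if "A\<^sub>0 < 0 \<or> A\<^sub>1 < 0"
    using lr_upper_dominance[OF _ bayes_optimal_lr_upper[OF bayes_optimal_compl[OF opt] lr_invariant_compl[OF inv]] P]
      that S by (auto simp: class_measure_compl[OF *(1)] class_measure_compl[OF *(2)]
        class_measure_compl[OF *(3)] class_measure_compl[OF *(4)])
  show "A\<^sub>0 * measure P\<^sub>0 S \<le> A\<^sub>0 * measure Q\<^sub>0 S"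
    using pos(1) neg(1) by (cases A\<^sub>0 "0 :: real" rule: linorder_cases) (auto intro: mult_left_mono mult_left_mono_neg)
  show "A\<^sub>1 * measure Q\<^sub>1 S \<le> A\<^sub>1 * measure P\<^sub>1 S"
    using pos(2) neg(2) by (cases A\<^sub>1 "0 :: real" rule: linorder_cases) (auto intro: mult_left_mono mult_left_mono_neg)
qed

text \<open>Disjoint classes keep the two least favorable laws distinct; a set on which they differ
  in the wrong direction is replaced by its complement.\<close>

lemma lfd_separated: "\<exists>S\<in>sets M. measure Q\<^sub>0 S < measure Q\<^sub>1 S"
proof -
  have *: "Q\<^sub>0 \<in> \<P>\<^sub>0 \<union> \<P>\<^sub>1" "Q\<^sub>1 \<in> \<P>\<^sub>0 \<union> \<P>\<^sub>1" using lfd_in_class by auto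
  interpret Q0: prob_space Q\<^sub>0 using class_prob_space[OF *(1)] .
  interpret Q1: prob_space Q\<^sub>1 using class_prob_space[OF *(2)] .
  have "Q\<^sub>0 \<noteq> Q\<^sub>1" using disjoint lfd_in_class by auto
  hence "\<exists>S\<in>sets M. measure Q\<^sub>0 S \<noteq> measure Q\<^sub>1 S"
    using measure_eqI[of Q\<^sub>0 Q\<^sub>1] by (auto simp: Q0.emeasure_eq_measure Q1.emeasure_eq_measure)
  then obtain S where S: "S \<in> sets M" "measure Q\<^sub>0 S \<noteq> measure Q\<^sub>1 S" by blast
  show ?thesis
  proof (cases "measure Q\<^sub>0 S < measure Q\<^sub>1 S")
    case False
    hence "measure Q\<^sub>0 (space M - S) < measure Q\<^sub>1 (space M - S)"
      using S by (simp add: class_measure_compl[OF *(1)] class_measure_compl[OF *(2)])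
    thus ?thesis using S(1) by blast
  qed (use S in blast)
qed

text \<open>Suppose \<open>Q\<^sub>1\<close> gives \<open>S\<close> no more mass than
  \<open>Q\<^sub>0\<close> does, outside the deterministic cases. Comparison with the empty set and
  the whole space forces \<open>A\<^sub>0 = A\<^sub>1\<close>, and then a set from
  \<open>lfd_separated\<close> is strictly better.\<close>

lemma bayes_optimal_separates:
  assumes opt: "bayes_optimal A\<^sub>0 A\<^sub>1 S" and A: "0 < A\<^sub>0" "0 < A\<^sub>1"
  shows "measure Q\<^sub>0 S < measure Q\<^sub>1 S \<or> (measure Q\<^sub>0 S = 0 \<and> measure Q\<^sub>1 S = 0) \<or>
    (measure Q\<^sub>0 S = 1 \<and> measure Q\<^sub>1 S = 1)"
proof (rule ccontr)
  assume neg: "\<not> ?thesis"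
  have *: "Q\<^sub>0 \<in> \<P>\<^sub>0 \<union> \<P>\<^sub>1" "Q\<^sub>1 \<in> \<P>\<^sub>0 \<union> \<P>\<^sub>1" using lfd_in_class by auto
  have le: "A\<^sub>0 * measure Q\<^sub>0 S - A\<^sub>1 * measure Q\<^sub>1 S \<le>
      A\<^sub>0 * measure Q\<^sub>0 S' - A\<^sub>1 * measure Q\<^sub>1 S'" if "S' \<in> sets M" for S'
    using opt that by (auto simp: bayes_optimal_def)
  define a b where ab: "a = measure Q\<^sub>0 S" "b = measure Q\<^sub>1 S"
  have S: "S \<in> sets M" using opt by (simp add: bayes_optimal_def)
  have ge: "b \<le> a" "0 < a" "b < 1"
    using neg class_measure_0_iff[OF * S] class_measure_1_iff[OF * S]
      prob_space.prob_le_1[OF class_prob_space[OF *(1)], of S]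
      prob_space.prob_le_1[OF class_prob_space[OF *(2)], of S]
    by (auto simp: ab not_less less_le)
  have 1: "A\<^sub>0 * a \<le> A\<^sub>1 * b" using le[of "{}"] by (simp add: ab)
  have 2: "A\<^sub>1 * (1 - b) \<le> A\<^sub>0 * (1 - a)"
    using le[of "space M"] prob_space.prob_space[OF class_prob_space[OF *(1)]]
      prob_space.prob_space[OF class_prob_space[OF *(2)]] by (simp add: ab algebra_simps)
  have "A\<^sub>0 * a \<le> A\<^sub>1 * a" using 1 ge A mult_left_mono[of b a A\<^sub>1] by linarith
  hence "A\<^sub>0 \<le> A\<^sub>1" using ge by simp
  moreover have "A\<^sub>1 * (1 - b) \<le> A\<^sub>0 * (1 - b)" using 2 ge A mult_left_mono[of "1 - a" "1 - b" A\<^sub>0] by linarith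
  hence "A\<^sub>1 \<le> A\<^sub>0" using ge by simp
  ultimately have eq: "A\<^sub>0 = A\<^sub>1" by simp
  hence "a \<le> b" using 1 A by simp
  moreover have "A\<^sub>0 * (a - b) < 0"
  proof -
    obtain S' where S': "S' \<in> sets M" "measure Q\<^sub>0 S' < measure Q\<^sub>1 S'" using lfd_separated by blast
    have "A\<^sub>0 * (a - b) \<le> A\<^sub>0 * (measure Q\<^sub>0 S' - measure Q\<^sub>1 S')"
      using le[OF S'(1)] eq by (simp add: ab right_diff_distrib)
    also have "\<dots> < 0" using A S' by (simp add: mult_less_0_iff)
    finally show ?thesis .
  qed
  ultimately show False using A ge by (simp add: mult_less_0_iff)
qed

text \<open>An exchange argument: optimality of each set against the other combines to
  \<open>(A\<^sub>0 * B\<^sub>1 - B\<^sub>0 * A\<^sub>1) * d \<ge> 0\<close>. The hypothesis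
  \<open>less\<close> says that \<open>T\<close> has the lower threshold.\<close>

lemma bayes_optimal_mono:
  assumes S: "bayes_optimal A\<^sub>0 A\<^sub>1 S" and T: "bayes_optimal B\<^sub>0 B\<^sub>1 T"
    and pos: "0 < A\<^sub>0" "0 < A\<^sub>1" "0 < B\<^sub>0" "0 < B\<^sub>1" and less: "B\<^sub>0 * A\<^sub>1 < A\<^sub>0 * B\<^sub>1"
  shows "measure Q\<^sub>0 S \<le> measure Q\<^sub>0 T" "measure Q\<^sub>1 S \<le> measure Q\<^sub>1 T"
proof -
  define d e where de: "d = measure Q\<^sub>0 T - measure Q\<^sub>0 S" "e = measure Q\<^sub>1 T - measure Q\<^sub>1 S"
  have 1: "A\<^sub>1 * e \<le> A\<^sub>0 * d" and 2: "B\<^sub>0 * d \<le> B\<^sub>1 * e"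
    using S T by (auto simp: bayes_optimal_def de algebra_simps)
  have "A\<^sub>1 * (B\<^sub>0 * d) \<le> A\<^sub>1 * (B\<^sub>1 * e)" "B\<^sub>1 * (A\<^sub>1 * e) \<le> B\<^sub>1 * (A\<^sub>0 * d)"
    using 1 2 pos by auto
  hence "0 \<le> (A\<^sub>0 * B\<^sub>1 - B\<^sub>0 * A\<^sub>1) * d" by (simp add: algebra_simps)
  hence "0 \<le> d" using less by (simp add: zero_le_mult_iff)
  moreover from this have "0 \<le> B\<^sub>1 * e" using 2 pos mult_nonneg_nonneg[of B\<^sub>0 d] by linarith
  hence "0 \<le> e" using pos by (simp add: zero_le_mult_iff)
  ultimately show "measure Q\<^sub>0 S \<le> measure Q\<^sub>0 T" "measure Q\<^sub>1 S \<le> measure Q\<^sub>1 T" by (simp_all add: de)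
qed

end

subsection \<open>Two-state chains\<close>

text \<open>Here \<open>f u\<close> is the probability of deciding 1 on receiving \<open>u\<close>,
  and \<open>r\<close> the probability of receiving 1.\<close>

definition transition :: "(bool \<Rightarrow> real) \<Rightarrow> real \<Rightarrow> real" where
  "transition f r = (1 - r) * f False + r * f True"

text \<open>The \<open>m\<close> agents following agent \<open>k\<close>, where \<open>r\<close> is
  the probability that agent \<open>k\<close> decides 1. The whole network starts at
  \<open>k = 0\<close> with \<open>r = 0\<close>, the constant initial decision.\<close>

fun propagate :: "(nat \<Rightarrow> bool \<Rightarrow> real) \<Rightarrow> nat \<Rightarrow> nat \<Rightarrow> real \<Rightarrow> real" where
  "propagate x k 0 r = r"
| "propagate x k (Suc m) r = propagate x (Suc k) m (transition (x (Suc k)) r)"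

lemma propagate_add: "propagate x k (l + m) r = propagate x (k + l) m (propagate x k l r)"
  by (induction l arbitrary: k r) auto

lemma propagate_Suc: "propagate x 0 (Suc n) r = transition (x (Suc n)) (propagate x 0 n r)"
  using propagate_add[of x 0 n 1 r] by simp

lemma propagate_cong:
  assumes "\<And>j. k < j \<Longrightarrow> j \<le> k + m \<Longrightarrow> x j = x' j"
  shows "propagate x k m r = propagate x' k m r"
  using assms
proof (induction m arbitrary: k r)
  case (Suc m)
  have "x (Suc k) = x' (Suc k)" by (rule Suc.prems) auto
  thus ?case using Suc.IH[of "Suc k"] Suc.prems by simp
qed simp

text \<open>The chain is affine in its starting probability. The slope, the difference between
  starts 1 and 0, is the influence of a decision on the final one.\<close>

lemma propagate_diff:
  "propagate x k m r - propagate x k m s = (r - s) * (propagate x k m 1 - propagate x k m 0)"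
proof (induction m arbitrary: k r s)
  case (Suc m)
  let ?D = "propagate x (Suc k) m 1 - propagate x (Suc k) m 0"
  have "propagate x k (Suc m) r - propagate x k (Suc m) s =
      (transition (x (Suc k)) r - transition (x (Suc k)) s) * ?D"
    unfolding propagate.simps(2) by (rule Suc.IH)
  moreover have "propagate x k (Suc m) 1 - propagate x k (Suc m) 0 =
      (transition (x (Suc k)) 1 - transition (x (Suc k)) 0) * ?D"
    unfolding propagate.simps(2) by (rule Suc.IH)
  moreover have "transition (x (Suc k)) r - transition (x (Suc k)) s =
      (r - s) * (transition (x (Suc k)) 1 - transition (x (Suc k)) 0)"
    by (simp add: transition_def algebra_simps)
  ultimately show ?case by (simp only: mult.assoc)
qed simp

definition state_weight :: "bool \<Rightarrow> real \<Rightarrow> real" where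
  "state_weight u r = (if u then r else 1 - r)"

lemma transition_diff:
  "transition f r - transition g r =
     state_weight False r * (f False - g False) + state_weight True r * (f True - g True)"
  by (simp add: transition_def state_weight_def algebra_simps)

lemma transition_upd_diff:
  "transition (f(u := v)) r - transition f r = state_weight u r * (v - f u)"
  by (cases u) (simp_all add: transition_def state_weight_def algebra_simps)

text \<open>The altered entry acts with the probability of receiving \<open>u\<close>, and its
  change is carried to the end by the slope of the later steps; the alteration affects neither
  factor.\<close>

lemma propagate_upd_diff:
  assumes "k < n"
  shows "propagate (x(Suc k := (x (Suc k))(u := v))) 0 n 0 - propagate x 0 n 0 =
    state_weight u (propagate x 0 k 0) *
      (propagate x (Suc k) (n - Suc k) 1 - propagate x (Suc k) (n - Suc k) 0) * (v - x (Suc k) u)"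
proof -
  define x' where "x' = x(Suc k := (x (Suc k))(u := v))"
  have n: "n = Suc k + (n - Suc k)" using assms by simp
  have 1: "propagate z 0 n 0 = propagate z (Suc k) (n - Suc k) (transition (z (Suc k)) (propagate z 0 k 0))" for z
    by (subst n, subst propagate_add) (simp add: propagate_Suc del: propagate.simps(2))
  have 2: "propagate x' (Suc k) (n - Suc k) r = propagate x (Suc k) (n - Suc k) r" for r
    by (rule propagate_cong) (simp add: x'_def)
  have 3: "propagate x' 0 k 0 = propagate x 0 k 0"
    by (rule propagate_cong) (simp add: x'_def)
  have "propagate x' 0 n 0 - propagate x 0 n 0 =
     (transition (x' (Suc k)) (propagate x 0 k 0) - transition (x (Suc k)) (propagate x 0 k 0)) *
     (propagate x (Suc k) (n - Suc k) 1 - propagate x (Suc k) (n - Suc k) 0)"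
    unfolding 1 2 3 by (rule propagate_diff)
  thus ?thesis by (simp add: x'_def transition_upd_diff)
qed

definition step_probs :: "(nat \<Rightarrow> bool \<Rightarrow> real) \<Rightarrow> nat \<Rightarrow> bool" where
  "step_probs x n \<longleftrightarrow> (\<forall>j\<in>{1..n}. \<forall>u. x j u \<in> {0..1})"

lemma transition_bounds:
  assumes "f False \<in> {0..1}" "f True \<in> {0..1}" "r \<in> {0..1}"
  shows "transition f r \<in> {0..1}"
proof -
  have "(1 - r) * f False \<le> (1 - r) * 1" "r * f True \<le> r * 1"
    using assms by (intro mult_left_mono; simp)+
  thus ?thesis using assms by (simp add: transition_def)
qed

lemma propagate_bounds:
  assumes "step_probs x n" "k \<le> n"
  shows "propagate x 0 k 0 \<in> {0..1}"
  using assms(2)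
proof (induction k)
  case (Suc k)
  thus ?case using assms(1) unfolding propagate_Suc
    by (intro transition_bounds) (auto simp: step_probs_def)
qed simp

text \<open>Absolute continuity enters only through the reachable decisions being the same.\<close>

definition equiv_steps :: "(nat \<Rightarrow> bool \<Rightarrow> real) \<Rightarrow> (nat \<Rightarrow> bool \<Rightarrow> real) \<Rightarrow> nat \<Rightarrow> bool" where
  "equiv_steps x z n \<longleftrightarrow> (\<forall>j\<in>{1..n}. \<forall>u. (x j u = 0 \<longleftrightarrow> z j u = 0) \<and> (x j u = 1 \<longleftrightarrow> z j u = 1))"

lemma transition_eq_0_iff:
  assumes "f False \<in> {0..1}" "f True \<in> {0..1}" "r \<in> {0..1}"
  shows "transition f r = 0 \<longleftrightarrow> (r = 1 \<or> f False = 0) \<and> (r = 0 \<or> f True = 0)"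
  using assms unfolding transition_def
  by (subst add_nonneg_eq_0_iff) auto

lemma transition_eq_1_iff:
  assumes "f False \<in> {0..1}" "f True \<in> {0..1}" "r \<in> {0..1}"
  shows "transition f r = 1 \<longleftrightarrow> (r = 1 \<or> f False = 1) \<and> (r = 0 \<or> f True = 1)"
proof -
  have "transition f r = 1 \<longleftrightarrow> transition (\<lambda>u. 1 - f u) r = 0"
    by (auto simp: transition_def algebra_simps)
  also have "\<dots> \<longleftrightarrow> (r = 1 \<or> f False = 1) \<and> (r = 0 \<or> f True = 1)"
    using assms by (subst transition_eq_0_iff) auto
  finally show ?thesis .
qed

text \<open>By the two criteria for \<open>transition\<close>, whether a state is certain depends
  only on which step probabilities are 0 or 1.\<close>

lemma equiv_steps_propagate:
  assumes "step_probs x n" "step_probs z n" "equiv_steps x z n" "k \<le> n"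
  shows "(propagate x 0 k 0 = 0 \<longleftrightarrow> propagate z 0 k 0 = 0) \<and>
         (propagate x 0 k 0 = 1 \<longleftrightarrow> propagate z 0 k 0 = 1)"
  using assms(4)
proof (induction k)
  case (Suc k)
  have b: "propagate x 0 k 0 \<in> {0..1}" "propagate z 0 k 0 \<in> {0..1}"
    using propagate_bounds[OF assms(1)] propagate_bounds[OF assms(2)] Suc.prems by auto
  have s: "x (Suc k) u \<in> {0..1}" "z (Suc k) u \<in> {0..1}" for u
    using assms(1,2) Suc.prems by (auto simp: step_probs_def)
  have e: "(x (Suc k) u = 0 \<longleftrightarrow> z (Suc k) u = 0) \<and> (x (Suc k) u = 1 \<longleftrightarrow> z (Suc k) u = 1)" for u
    using assms(3) Suc.prems by (auto simp: equiv_steps_def)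
  show ?case
    using Suc e[of True] e[of False]
    by (simp add: propagate_Suc transition_eq_0_iff[OF s(1) s(1) b(1)] transition_eq_0_iff[OF s(2) s(2) b(2)]
      transition_eq_1_iff[OF s(1) s(1) b(1)] transition_eq_1_iff[OF s(2) s(2) b(2)] del: propagate.simps(2))
qed simp

lemma equiv_steps_state_weight:
  assumes "step_probs x n" "step_probs z n" "equiv_steps x z n" "k \<le> n"
    and "state_weight u (propagate x 0 k 0) \<noteq> 0"
  shows "state_weight u (propagate z 0 k 0) > 0"
  using equiv_steps_propagate[OF assms(1-4)] propagate_bounds[OF assms(2,4)] assms(5)
  by (cases u) (auto simp: state_weight_def less_le)

text \<open>
  The steps are exchanged one at a time, the first \<open>k\<close> of them being those of \<open>z\<close>; each exchange
  changes the final probability by the slope of the remaining steps times the change in the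
  exchanged step.
\<close>

lemma propagate_exchange:
  fixes s :: real
  assumes x: "step_probs x n" and z: "step_probs z n" and eq: "equiv_steps z x n"
    and step: "\<And>k u. k < n \<Longrightarrow> 0 < state_weight u (propagate x 0 k 0) \<Longrightarrow>
      s * ((propagate x (Suc k) (n - Suc k) 1 - propagate x (Suc k) (n - Suc k) 0) *
        (z (Suc k) u - x (Suc k) u)) \<le> 0"
  shows "s * propagate z 0 n 0 \<le> s * propagate x 0 n 0"
proof -
  define H where "H k = s * propagate x k (n - k) (propagate z 0 k 0)" for k
  have "H (Suc k) \<le> H k" if k: "k < n" for k
  proof -
    define d where "d = propagate x (Suc k) (n - Suc k) 1 - propagate x (Suc k) (n - Suc k) 0"
    define r where "r = propagate z 0 k 0"
    have nk: "n - k = Suc (n - Suc k)" using k by simp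
    \<comment> \<open>The sign condition \<open>step\<close> concerns decisions reachable under
      \<open>x\<close>. By equivalence these include all decisions reachable under \<open>z\<close>;
      any other has weight zero here.\<close>
    have w: "state_weight u r * (s * (d * (z (Suc k) u - x (Suc k) u))) \<le> 0" for u
    proof (cases "state_weight u r = 0")
      case False
      hence "s * (d * (z (Suc k) u - x (Suc k) u)) \<le> 0"
        using step[OF k] equiv_steps_state_weight[OF z x eq, of k u] k by (simp add: r_def d_def)
      moreover have "0 \<le> state_weight u r"
        using propagate_bounds[OF z, of k] k by (auto simp: state_weight_def r_def)
      ultimately show ?thesis by (simp add: mult_nonneg_nonpos)
    qed simp
    have "H (Suc k) - H k = s * (propagate x (Suc k) (n - Suc k) (transition (z (Suc k)) r) -
       propagate x (Suc k) (n - Suc k) (transition (x (Suc k)) r))"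
      by (simp add: H_def nk r_def right_diff_distrib propagate_Suc[of z] del: propagate.simps(2)) simp
    also have "\<dots> = s * ((transition (z (Suc k)) r - transition (x (Suc k)) r) * d)"
      by (simp add: propagate_diff[of x "Suc k" _ "transition (z (Suc k)) r"] d_def)
    also have "\<dots> = state_weight False r * (s * (d * (z (Suc k) False - x (Suc k) False))) +
       state_weight True r * (s * (d * (z (Suc k) True - x (Suc k) True)))"
      by (simp add: transition_diff algebra_simps)
    also have "\<dots> \<le> 0" using w[of False] w[of True] by linarith
    finally show ?thesis by simp
  qed
  hence "k \<le> n \<Longrightarrow> H k \<le> H 0" for k
    by (induction k) (auto intro: order_trans simp: Suc_le_eq)
  from this[of n] show ?thesis by (simp add: H_def)
qed

text \<open>The sign condition does not involve the slope of later steps. A gap between the chains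
  keeps its sign because the steps of \<open>x\<close> increase with the received decision wherever
  that decision is uncertain.\<close>

lemma propagate_mono_exchange:
  fixes s :: real
  assumes x: "step_probs x n" and z: "step_probs z n" and eq: "equiv_steps z x n"
    and mono: "\<And>k. k < n \<Longrightarrow> 0 < propagate x 0 k 0 \<Longrightarrow> propagate x 0 k 0 < 1 \<Longrightarrow>
      x (Suc k) False \<le> x (Suc k) True"
    and step: "\<And>k u. k < n \<Longrightarrow> 0 < state_weight u (propagate x 0 k 0) \<Longrightarrow>
      s * (z (Suc k) u - x (Suc k) u) \<le> 0"
    and k: "k \<le> n"
  shows "s * propagate z 0 k 0 \<le> s * propagate x 0 k 0"
  using k
proof (induction k)
  case (Suc k)
  define rx rz where r: "rx = propagate x 0 k 0" "rz = propagate z 0 k 0"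
  have k: "k < n" "k \<le> n" using Suc.prems by auto
  have IH: "s * (rz - rx) \<le> 0" using Suc.IH k by (simp add: r algebra_simps)
  have b: "0 \<le> rx" "rx \<le> 1" "0 \<le> rz" "rz \<le> 1"
    using propagate_bounds[OF x k(2)] propagate_bounds[OF z k(2)] by (auto simp: r)
  have w: "state_weight u rz * (s * (z (Suc k) u - x (Suc k) u)) \<le> 0" for u
  proof (cases "state_weight u rz = 0")
    case False
    hence "s * (z (Suc k) u - x (Suc k) u) \<le> 0"
      using step[OF k(1)] equiv_steps_state_weight[OF z x eq k(2), of u] by (simp add: r)
    moreover have "0 \<le> state_weight u rz" using b by (simp add: state_weight_def)
    ultimately show ?thesis by (simp add: mult_nonneg_nonpos)
  qed simp
  have "s * (transition (z (Suc k)) rz - transition (x (Suc k)) rz) =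
      state_weight False rz * (s * (z (Suc k) False - x (Suc k) False)) +
      state_weight True rz * (s * (z (Suc k) True - x (Suc k) True))"
    unfolding transition_diff by (simp add: algebra_simps)
  also have "\<dots> \<le> 0" using w[of False] w[of True] by linarith
  finally have 1: "s * (transition (z (Suc k)) rz - transition (x (Suc k)) rz) \<le> 0" .
  have "s * (transition (x (Suc k)) rz - transition (x (Suc k)) rx) =
      (s * (rz - rx)) * (x (Suc k) True - x (Suc k) False)"
    by (simp add: transition_def algebra_simps)
  also have "\<dots> \<le> 0"
  proof (cases "0 < rx \<and> rx < 1")
    case True
    show ?thesis
      by (rule mult_nonpos_nonneg[OF IH]) (use True mono[OF k(1)] in \<open>simp add: r\<close>)
  next
    case False
    \<comment> \<open>A certain state is shared by both chains, so no gap has to be carried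
      on.\<close>
    hence "rx = 0 \<or> rx = 1" using b by auto
    hence "rz = rx" using equiv_steps_propagate[OF z x eq k(2)] by (auto simp: r)
    thus ?thesis by simp
  qed
  finally have 2: "s * (transition (x (Suc k)) rz - transition (x (Suc k)) rx) \<le> 0" .
  have "s * transition (z (Suc k)) rz \<le> s * transition (x (Suc k)) rx"
    using 1 2 unfolding right_diff_distrib by linarith
  thus ?case by (simp add: propagate_Suc r del: propagate.simps)
qed simp

text \<open>The invariant of social learning, for the probabilities of deciding 1 under the two
  hypotheses.\<close>

definition separated :: "real \<Rightarrow> real \<Rightarrow> bool" where
  "separated a b \<longleftrightarrow> a < b \<or> (a = 0 \<and> b = 0) \<or> (a = 1 \<and> b = 1)"

text \<open>Strictness comes from the received decision if \<open>g\<close> distinguishes its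
  values, or from the agent's own observation if \<open>f u < g u\<close> for some \<open>u\<close>.
  If neither happens, the step is constant and its own separation makes it deterministic.\<close>

lemma separated_transition:
  assumes sep: "separated a b" and pos: "a < b \<Longrightarrow> 0 < a" "a < b \<Longrightarrow> b < 1"
    and step: "\<And>u. 0 < state_weight u a \<Longrightarrow> 0 < state_weight u b \<Longrightarrow> separated (f u) (g u)"
    and mono: "a < b \<Longrightarrow> g False \<le> g True"
  shows "separated (transition f a) (transition g b)"
proof (cases "a < b")
  case False
  hence "a = 0 \<and> b = 0 \<or> a = 1 \<and> b = 1" using sep by (auto simp: separated_def)
  thus ?thesis
    using step[of False] step[of True] by (auto simp: transition_def state_weight_def)
next
  case True
  note ab = pos[OF True]
  have s: "separated (f u) (g u)" for u
    using step[of u] ab True by (auto simp: state_weight_def)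
  have le: "f u \<le> g u" for u using s[of u] by (auto simp: separated_def)
  have f: "(1 - a) * f False \<le> (1 - a) * g False" "a * f True \<le> a * g True"
    using le ab True by (auto intro!: mult_left_mono)
  \<comment> \<open>The mass \<open>b - a\<close> by which a received 1 is likelier under the second
    hypothesis is split off.\<close>
  have diff: "transition g b = (1 - a) * g False + a * g True + (b - a) * (g True - g False)"
    by (simp add: transition_def algebra_simps)
  consider "g False < g True" | "g False = g True" "\<exists>u. f u < g u" | "g False = g True" "\<And>u. f u = g u"
    using mono[OF True] le by (metis less_le)
  thus ?thesis
  proof cases
    case 1
    hence "0 < (b - a) * (g True - g False)" using True by simp
    hence "transition f a < transition g b"
      using f unfolding diff unfolding transition_def by linarith
    thus ?thesis by (simp add: separated_def)
  next
    case 2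
    then obtain u where "f u < g u" by blast
    hence "(1 - a) * f False < (1 - a) * g False \<or> a * f True < a * g True"
      using ab True by (cases u) auto
    moreover have "(b - a) * (g True - g False) = 0" using 2 by simp
    ultimately have "transition f a < transition g b"
      using f unfolding diff unfolding transition_def by linarith
    thus ?thesis by (simp add: separated_def)
  next
    case 3
    have "transition f a = g True" "transition g b = g True"
      using 3(1) by (simp_all add: 3(2) transition_def algebra_simps)
    thus ?thesis using s[of True] by (simp add: 3(2))
  qed
qed

subsection \<open>Tandem networks\<close>

lemma decision_cong:
  assumes "\<And>j. j \<in> {1..k} \<Longrightarrow> y j = y' j"
  shows "decision \<phi> k y = decision \<phi> k y'"
  using assms by (induction k) auto

lemma measurable_decision:
  assumes "decision_rules M n \<phi>" "\<And>j. j \<in> I \<Longrightarrow> sets (P j) = sets M" "{1..n} \<subseteq> I"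
  shows "decision \<phi> n \<in> measurable (PiM I P) (count_space UNIV)"
  using assms(1,3)
proof (induction n)
  case (Suc n)
  have [measurable]: "decision \<phi> n \<in> measurable (PiM I P) (count_space UNIV)"
    by (rule Suc.IH) (use Suc.prems in \<open>auto simp: decision_rules_def\<close>)
  have [measurable]: "(\<lambda>y. \<phi> (Suc n) (y (Suc n)) u) \<in> measurable (PiM I P) (count_space UNIV)" for u
  proof (rule measurable_compose[where N = M])
    have "Suc n \<in> I" using Suc.prems by auto
    thus "(\<lambda>y. y (Suc n)) \<in> measurable (PiM I P) M"
      using measurable_component_singleton[of "Suc n" I P] assms(2)[of "Suc n"]
      by (simp cong: measurable_cong_sets)
    show "(\<lambda>y. \<phi> (Suc n) y u) \<in> measurable M (count_space UNIV)"
      using Suc.prems(1) by (auto simp: decision_rules_def decision_rule_def)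
  qed
  have "decision \<phi> (Suc n) = (\<lambda>y. if decision \<phi> n y then \<phi> (Suc n) (y (Suc n)) True else \<phi> (Suc n) (y (Suc n)) False)"
    by (rule ext) simp
  also have "\<dots> \<in> measurable (PiM I P) (count_space UNIV)" by measurable
  finally show ?case .
next
  case 0
  have "decision \<phi> 0 = (\<lambda>_. False)" by (rule ext) simp
  thus ?case by simp
qed

text \<open>Using \<open>space M\<close> instead of \<open>space (P j)\<close> keeps the decision
  set the same for every law of an agent.\<close>

definition law_steps :: "'y measure \<Rightarrow> (nat \<Rightarrow> 'y measure) \<Rightarrow> (nat \<Rightarrow> 'y rule) \<Rightarrow> nat \<Rightarrow> bool \<Rightarrow> real" where
  "law_steps M P \<phi> j u = measure (P j) {y \<in> space M. \<phi> j y u}"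

text \<open>The received decision depends on earlier observations only, so integrating out the last
  coordinate first produces one \<open>transition\<close>.\<close>

lemma measure_decision:
  assumes rules: "decision_rules M n \<phi>"
    and P: "\<And>j. j \<in> {1..n} \<Longrightarrow> prob_space (P j)" "\<And>j. j \<in> {1..n} \<Longrightarrow> sets (P j) = sets M"
  shows "measure (PiM {1..n} P) {y \<in> space (PiM {1..n} P). decision \<phi> n y} = propagate (law_steps M P \<phi>) 0 n 0"
proof -
  \<comment> \<open>\<open>product_prob_space\<close> wants a probability law at every index; those
    outside \<open>{1..n}\<close> get an arbitrary one.\<close>
  define P' where "P' j = (if j \<in> {1..n} then P j else return (count_space UNIV) undefined)" for j
  have P': "prob_space (P' j)" for j
    using P(1) by (auto simp: P'_def intro: prob_space_return)
  interpret P: product_prob_space P' "{1..n}"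
    by (rule product_prob_spaceI) (rule P')
  have "measure (PiM {1..k} P') {y \<in> space (PiM {1..k} P'). decision \<phi> k y} =
      propagate (law_steps M P \<phi>) 0 k 0" if "k \<le> n" for k
    using that
  proof (induction k)
    case (Suc k)
    let ?S = "Suc k"
    define J where "J = {1..k}"
    have I: "{1..?S} = insert ?S J" and J: "finite J" "?S \<notin> J" by (auto simp: J_def)
    have sets: "sets (P' j) = sets M" if "j \<in> {1..?S}" for j
      using that Suc.prems P(2) by (simp add: P'_def)
    have rule: "decision_rule M (\<phi> ?S)" and rules': "decision_rules M k \<phi>" "decision_rules M ?S \<phi>"
      using rules Suc.prems by (auto simp: decision_rules_def)
    interpret K: prob_space "PiM J P'" by (rule prob_space_PiM) (rule P')
    define F where "F = {y \<in> space (PiM {1..?S} P'). decision \<phi> ?S y}"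
    define G where "G = {y \<in> space (PiM J P'). decision \<phi> k y}"
    define D where "D u = {y \<in> space M. \<phi> ?S y u}" for u
    have [measurable]: "decision \<phi> ?S \<in> measurable (PiM {1..?S} P') (count_space UNIV)"
      "decision \<phi> k \<in> measurable (PiM J P') (count_space UNIV)"
      by (rule measurable_decision[OF rules'(2)]; use sets in simp)
         (rule measurable_decision[OF rules'(1)]; use sets in \<open>simp add: J_def\<close>)
    have F: "F \<in> sets (PiM (insert ?S J) P')" unfolding F_def I[symmetric] by measurable
    have G [measurable]: "G \<in> sets (PiM J P')" unfolding G_def by measurable
    have D: "D u \<in> sets (P' ?S)" for u
      using rule sets[of ?S] unfolding D_def decision_rule_def by (auto simp: pred_def)
    have space: "space (P' ?S) = space M" using sets[of ?S] by (auto dest: sets_eq_imp_space_eq)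
    have xD: "measure (P' ?S) (D u) = law_steps M P \<phi> ?S u" for u
      using Suc.prems by (simp add: P'_def D_def law_steps_def)
    \<comment> \<open>With the earlier observations \<open>w\<close> fixed, the section of
      \<open>F\<close> is the decision set for the received
      \<open>decision \<phi> k w\<close>.\<close>
    have inner: "(\<integral>\<^sup>+ y. indicator F (w(?S := y)) \<partial>P' ?S) =
        emeasure (P' ?S) (D True) * indicator G w + emeasure (P' ?S) (D False) * indicator (space (PiM J P') - G) w"
      if w: "w \<in> space (PiM J P')" for w
    proof -
      have "indicator F (w(?S := y)) = (indicator (D (decision \<phi> k w)) y :: ennreal)" if y: "y \<in> space (P' ?S)" for y
      proof -
        have "w(?S := y) \<in> space (PiM {1..?S} P')"
          using w y unfolding I space_PiM by (auto intro!: PiE_fun_upd)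
        moreover have "decision \<phi> k (w(?S := y)) = decision \<phi> k w" by (rule decision_cong) auto
        ultimately show ?thesis using y space by (auto simp: F_def D_def split: split_indicator)
      qed
      hence "(\<integral>\<^sup>+ y. indicator F (w(?S := y)) \<partial>P' ?S) = (\<integral>\<^sup>+ y. indicator (D (decision \<phi> k w)) y \<partial>P' ?S)"
        by (intro nn_integral_cong) auto
      also have "\<dots> = emeasure (P' ?S) (D (decision \<phi> k w))" using D by simp
      finally show ?thesis using w by (cases "decision \<phi> k w") (auto simp: G_def)
    qed
    have "emeasure (PiM {1..?S} P') F = (\<integral>\<^sup>+ y. indicator F y \<partial>PiM (insert ?S J) P')"
      unfolding I using F by simp
    also have "\<dots> = (\<integral>\<^sup>+ w. (\<integral>\<^sup>+ y. indicator F (w(?S := y)) \<partial>P' ?S) \<partial>PiM J P')"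
      using F J by (intro P.product_nn_integral_insert) auto
    also have "\<dots> = (\<integral>\<^sup>+ w. emeasure (P' ?S) (D True) * indicator G w +
        emeasure (P' ?S) (D False) * indicator (space (PiM J P') - G) w \<partial>PiM J P')"
      by (intro nn_integral_cong inner)
    also have "\<dots> = emeasure (P' ?S) (D True) * emeasure (PiM J P') G +
        emeasure (P' ?S) (D False) * emeasure (PiM J P') (space (PiM J P') - G)"
      by (subst nn_integral_add) (simp_all add: nn_integral_cmult_indicator)
    finally have "emeasure (PiM {1..?S} P') F = ennreal (measure (P' ?S) (D True) * measure (PiM J P') G +
        measure (P' ?S) (D False) * measure (PiM J P') (space (PiM J P') - G))"
      by (simp add: K.emeasure_eq_measure P.M.emeasure_eq_measure flip: ennreal_mult ennreal_plus)
    hence "measure (PiM {1..?S} P') F = measure (P' ?S) (D True) * measure (PiM J P') G +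
        measure (P' ?S) (D False) * measure (PiM J P') (space (PiM J P') - G)"
      by (rule measure_eq_emeasure_eq_ennreal[rotated]) simp
    also have "\<dots> = transition (law_steps M P \<phi> ?S) (measure (PiM J P') G)"
      by (simp add: K.prob_compl xD transition_def algebra_simps)
    also have "measure (PiM J P') G = propagate (law_steps M P \<phi>) 0 k 0"
      using Suc.IH Suc.prems by (simp add: G_def J_def)
    finally show ?case by (simp add: F_def propagate_Suc del: propagate.simps decision.simps)
  qed simp
  moreover have "PiM {1..n} P' = PiM {1..n} P"
    by (rule PiM_cong) (auto simp: P'_def)
  ultimately show ?thesis by (metis order_refl)
qed

lemma law_steps_bounds:
  assumes "\<And>j. j \<in> {1..n} \<Longrightarrow> prob_space (P j)"
  shows "step_probs (law_steps M P \<phi>) n"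
  using assms by (auto simp: step_probs_def law_steps_def intro: prob_space.prob_le_1)

lemma law_steps_fun_upd:
  assumes "S \<in> sets M"
  shows "law_steps M P (\<phi>(k := \<lambda>y v. if v = u then y \<in> S else \<phi> k y v)) =
    (law_steps M P \<phi>)(k := (law_steps M P \<phi> k)(u := measure (P k) S))"
proof -
  have "{y \<in> space M. y \<in> S} = S" using sets.sets_into_space[OF assms] by auto
  thus ?thesis by (auto simp: law_steps_def fun_eq_iff)
qed

lemma error_prob_propagate:
  assumes rules: "decision_rules M n \<phi>"
    and P: "\<And>j. j \<in> {1..n} \<Longrightarrow> prob_space (P\<^sub>0 j) \<and> sets (P\<^sub>0 j) = sets M"
      "\<And>j. j \<in> {1..n} \<Longrightarrow> prob_space (P\<^sub>1 j) \<and> sets (P\<^sub>1 j) = sets M"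
  shows "error_prob \<pi>\<^sub>0 \<pi>\<^sub>1 n \<phi> (PiM {1..n} P\<^sub>0) (PiM {1..n} P\<^sub>1) =
    \<pi>\<^sub>0 * propagate (law_steps M P\<^sub>0 \<phi>) 0 n 0 + \<pi>\<^sub>1 * (1 - propagate (law_steps M P\<^sub>1 \<phi>) 0 n 0)"
proof -
  interpret prob_space "PiM {1..n} P\<^sub>1" by (rule prob_space_PiM) (use P in auto)
  have [measurable]: "decision \<phi> n \<in> measurable (PiM {1..n} P\<^sub>1) (count_space UNIV)"
    by (rule measurable_decision[OF rules]) (use P in auto)
  let ?E = "{y \<in> space (PiM {1..n} P\<^sub>1). decision \<phi> n y}"
  have E: "?E \<in> sets (PiM {1..n} P\<^sub>1)" by measurable
  have "{y \<in> space (PiM {1..n} P\<^sub>1). \<not> decision \<phi> n y} = space (PiM {1..n} P\<^sub>1) - ?E" by auto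
  hence "measure (PiM {1..n} P\<^sub>1) {y \<in> space (PiM {1..n} P\<^sub>1). \<not> decision \<phi> n y} =
      1 - measure (PiM {1..n} P\<^sub>1) ?E"
    by (simp only: prob_compl[OF E])
  also have "measure (PiM {1..n} P\<^sub>1) ?E = propagate (law_steps M P\<^sub>1 \<phi>) 0 n 0"
    by (rule measure_decision[OF rules]) (use P in auto)
  finally have "measure (PiM {1..n} P\<^sub>1) {y \<in> space (PiM {1..n} P\<^sub>1). \<not> decision \<phi> n y} =
      1 - propagate (law_steps M P\<^sub>1 \<phi>) 0 n 0" .
  moreover have "measure (PiM {1..n} P\<^sub>0) {y \<in> space (PiM {1..n} P\<^sub>0). decision \<phi> n y} =
      propagate (law_steps M P\<^sub>0 \<phi>) 0 n 0"
    by (rule measure_decision[OF rules]) (use P in auto)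
  ultimately show ?thesis by (simp only: error_prob_def)
qed

section \<open>Worst-case error and single-agent deviations\<close>

locale tandem =
  fixes M :: "'y measure" and N :: nat and \<pi>\<^sub>0 \<pi>\<^sub>1 :: real and p\<^sub>0 p\<^sub>1 :: "'y \<Rightarrow> ennreal"
    and \<epsilon>\<^sub>0 \<epsilon>\<^sub>1 :: "nat \<Rightarrow> real" and c_lo c_hi :: "nat \<Rightarrow> ennreal"
  assumes pair: "\<And>k. k \<in> {1..N} \<Longrightarrow> contaminated_pair M p\<^sub>0 p\<^sub>1 (\<epsilon>\<^sub>0 k) (\<epsilon>\<^sub>1 k) (c_lo k) (c_hi k)"
    and prior: "0 < \<pi>\<^sub>0" "0 < \<pi>\<^sub>1" "\<pi>\<^sub>0 + \<pi>\<^sub>1 = 1"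
begin

abbreviation "\<P>\<^sub>0 k \<equiv> contamination_class (\<epsilon>\<^sub>0 k) (density M p\<^sub>0)"
abbreviation "\<P>\<^sub>1 k \<equiv> contamination_class (\<epsilon>\<^sub>1 k) (density M p\<^sub>1)"
abbreviation "q\<^sub>0 k \<equiv> lfd_density0 (\<epsilon>\<^sub>0 k) (c_hi k) p\<^sub>0 p\<^sub>1"
abbreviation "q\<^sub>1 k \<equiv> lfd_density1 (\<epsilon>\<^sub>1 k) (c_lo k) p\<^sub>0 p\<^sub>1"
abbreviation "Q\<^sub>0 k \<equiv> density M (q\<^sub>0 k)"
abbreviation "Q\<^sub>1 k \<equiv> density M (q\<^sub>1 k)"

abbreviation lfd_error :: "nat \<Rightarrow> (nat \<Rightarrow> 'y rule) \<Rightarrow> real" where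
  "lfd_error n \<phi> \<equiv> error_prob \<pi>\<^sub>0 \<pi>\<^sub>1 n \<phi> (PiM {1..n} Q\<^sub>0) (PiM {1..n} Q\<^sub>1)"

abbreviation worst_error :: "nat \<Rightarrow> (nat \<Rightarrow> 'y rule) \<Rightarrow> real" where
  "worst_error \<equiv> DD_risk \<pi>\<^sub>0 \<pi>\<^sub>1 \<P>\<^sub>0 \<P>\<^sub>1"

abbreviation optimal_at :: "nat \<Rightarrow> real \<Rightarrow> real \<Rightarrow> 'y set \<Rightarrow> bool" where
  "optimal_at k \<equiv> contaminated_pair.bayes_optimal M p\<^sub>0 p\<^sub>1 (\<epsilon>\<^sub>0 k) (\<epsilon>\<^sub>1 k) (c_lo k) (c_hi k)"

lemma class_laws:
  "P \<in> \<P>\<^sub>0 k \<union> \<P>\<^sub>1 k \<Longrightarrow> prob_space P \<and> sets P = sets M"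
  by (auto simp: contamination_class_def)

lemma lfd_in_class:
  "k \<in> {1..N} \<Longrightarrow> Q\<^sub>0 k \<in> \<P>\<^sub>0 k" "k \<in> {1..N} \<Longrightarrow> Q\<^sub>1 k \<in> \<P>\<^sub>1 k"
  using contaminated_pair.lfd_in_class[OF pair] by auto

lemma class_error:
  assumes "decision_rules M n \<phi>" "\<And>j. j \<in> {1..n} \<Longrightarrow> P\<^sub>0 j \<in> \<P>\<^sub>0 j" "\<And>j. j \<in> {1..n} \<Longrightarrow> P\<^sub>1 j \<in> \<P>\<^sub>1 j"
  shows "error_prob \<pi>\<^sub>0 \<pi>\<^sub>1 n \<phi> (PiM {1..n} P\<^sub>0) (PiM {1..n} P\<^sub>1) =
    \<pi>\<^sub>0 * propagate (law_steps M P\<^sub>0 \<phi>) 0 n 0 + \<pi>\<^sub>1 * (1 - propagate (law_steps M P\<^sub>1 \<phi>) 0 n 0)"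
  by (rule error_prob_propagate[OF assms(1)]; rule class_laws; use assms(2,3) in blast)

lemma lfd_error_eq:
  assumes "n \<le> N" "decision_rules M n \<phi>"
  shows "lfd_error n \<phi> =
    \<pi>\<^sub>0 * propagate (law_steps M Q\<^sub>0 \<phi>) 0 n 0 + \<pi>\<^sub>1 * (1 - propagate (law_steps M Q\<^sub>1 \<phi>) 0 n 0)"
  by (rule class_error[OF assms(2)]; rule lfd_in_class; use assms(1) in simp)

text \<open>A real supremum bounds the members of its family only when the family is bounded above;
  here \<open>\<pi>\<^sub>0 + \<pi>\<^sub>1\<close> is a bound.\<close>

lemma lfd_error_le_worst:
  assumes "n \<le> N" "decision_rules M n \<phi>"
  shows "lfd_error n \<phi> \<le> worst_error n \<phi>"
proof -
  have "error_prob \<pi>\<^sub>0 \<pi>\<^sub>1 n \<phi> M\<^sub>0 M\<^sub>1 \<le> \<pi>\<^sub>0 * 1 + \<pi>\<^sub>1 * 1"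
    if "M\<^sub>0 \<in> product_class \<P>\<^sub>0 n" "M\<^sub>1 \<in> product_class \<P>\<^sub>1 n" for M\<^sub>0 M\<^sub>1
  proof -
    have "prob_space M\<^sub>0" "prob_space M\<^sub>1"
      using that class_laws unfolding product_class_def by (auto intro!: prob_space_PiM)
    thus ?thesis
      using prior unfolding error_prob_def
      by (intro add_mono mult_left_mono prob_space.prob_le_1) auto
  qed
  hence bdd: "bdd_above ((\<lambda>(M\<^sub>0, M\<^sub>1). error_prob \<pi>\<^sub>0 \<pi>\<^sub>1 n \<phi> M\<^sub>0 M\<^sub>1) ` (product_class \<P>\<^sub>0 n \<times> product_class \<P>\<^sub>1 n))"
    by (intro bdd_aboveI2[where M = "\<pi>\<^sub>0 * 1 + \<pi>\<^sub>1 * 1"]) auto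
  have "PiM {1..n} Q\<^sub>0 \<in> product_class \<P>\<^sub>0 n" "PiM {1..n} Q\<^sub>1 \<in> product_class \<P>\<^sub>1 n"
    unfolding product_class_def using lfd_in_class assms(1) by (force intro!: exI)+
  hence "(PiM {1..n} Q\<^sub>0, PiM {1..n} Q\<^sub>1) \<in> product_class \<P>\<^sub>0 n \<times> product_class \<P>\<^sub>1 n" by simp
  from cSUP_upper[OF this bdd] show ?thesis by (simp add: DD_risk_def)
qed

text \<open>The hypotheses decouple: their laws vary independently, and the error increases in the
  first probability of a final 1 and decreases in the second.\<close>

lemma worst_error_le:
  assumes n: "n \<le> N" and rules: "decision_rules M n \<phi>"
    and le: "\<And>P\<^sub>0 P\<^sub>1. (\<And>j. j \<in> {1..n} \<Longrightarrow> P\<^sub>0 j \<in> \<P>\<^sub>0 j) \<Longrightarrow> (\<And>j. j \<in> {1..n} \<Longrightarrow> P\<^sub>1 j \<in> \<P>\<^sub>1 j) \<Longrightarrow>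
      propagate (law_steps M P\<^sub>0 \<phi>) 0 n 0 \<le> propagate (law_steps M Q\<^sub>0 \<phi>) 0 n 0 \<and>
      propagate (law_steps M Q\<^sub>1 \<phi>) 0 n 0 \<le> propagate (law_steps M P\<^sub>1 \<phi>) 0 n 0"
  shows "worst_error n \<phi> \<le> lfd_error n \<phi>"
  unfolding DD_risk_def
proof (rule cSUP_least)
  have "PiM {1..n} Q\<^sub>0 \<in> product_class \<P>\<^sub>0 n" "PiM {1..n} Q\<^sub>1 \<in> product_class \<P>\<^sub>1 n"
    unfolding product_class_def using lfd_in_class n by (force intro!: exI)+
  thus "product_class \<P>\<^sub>0 n \<times> product_class \<P>\<^sub>1 n \<noteq> {}" by blast
next
  fix z assume "z \<in> product_class \<P>\<^sub>0 n \<times> product_class \<P>\<^sub>1 n"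
  then obtain P\<^sub>0 P\<^sub>1 where z: "z = (PiM {1..n} P\<^sub>0, PiM {1..n} P\<^sub>1)"
    and P: "\<And>j. j \<in> {1..n} \<Longrightarrow> P\<^sub>0 j \<in> \<P>\<^sub>0 j" "\<And>j. j \<in> {1..n} \<Longrightarrow> P\<^sub>1 j \<in> \<P>\<^sub>1 j"
    unfolding product_class_def by blast
  have "propagate (law_steps M P\<^sub>0 \<phi>) 0 n 0 \<le> propagate (law_steps M Q\<^sub>0 \<phi>) 0 n 0"
    and "1 - propagate (law_steps M P\<^sub>1 \<phi>) 0 n 0 \<le> 1 - propagate (law_steps M Q\<^sub>1 \<phi>) 0 n 0"
    using le[of P\<^sub>0 P\<^sub>1] P by auto
  hence "\<pi>\<^sub>0 * propagate (law_steps M P\<^sub>0 \<phi>) 0 n 0 + \<pi>\<^sub>1 * (1 - propagate (law_steps M P\<^sub>1 \<phi>) 0 n 0) \<le>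
      lfd_error n \<phi>"
    unfolding lfd_error_eq[OF n rules] using prior by (intro add_mono mult_left_mono) auto
  also have "\<pi>\<^sub>0 * propagate (law_steps M P\<^sub>0 \<phi>) 0 n 0 + \<pi>\<^sub>1 * (1 - propagate (law_steps M P\<^sub>1 \<phi>) 0 n 0) =
      error_prob \<pi>\<^sub>0 \<pi>\<^sub>1 n \<phi> (PiM {1..n} P\<^sub>0) (PiM {1..n} P\<^sub>1)"
    by (rule class_error[symmetric]) (use rules P in auto)
  finally have "error_prob \<pi>\<^sub>0 \<pi>\<^sub>1 n \<phi> (PiM {1..n} P\<^sub>0) (PiM {1..n} P\<^sub>1) \<le> lfd_error n \<phi>" .
  thus "(case z of (M\<^sub>0, M\<^sub>1) \<Rightarrow> error_prob \<pi>\<^sub>0 \<pi>\<^sub>1 n \<phi> M\<^sub>0 M\<^sub>1) \<le> lfd_error n \<phi>"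
    by (simp add: z)
qed

lemma class_equiv_steps:
  assumes rules: "decision_rules M n \<phi>" and n: "n \<le> N"
    and P: "\<And>j. j \<in> {1..n} \<Longrightarrow> P j \<in> \<P>\<^sub>0 j \<union> \<P>\<^sub>1 j" "\<And>j. j \<in> {1..n} \<Longrightarrow> P' j \<in> \<P>\<^sub>0 j \<union> \<P>\<^sub>1 j"
  shows "equiv_steps (law_steps M P \<phi>) (law_steps M P' \<phi>) n"
  unfolding equiv_steps_def
proof (intro ballI allI)
  fix j u assume j: "j \<in> {1..n}"
  hence "contaminated_pair M p\<^sub>0 p\<^sub>1 (\<epsilon>\<^sub>0 j) (\<epsilon>\<^sub>1 j) (c_lo j) (c_hi j)" using n by (intro pair) auto
  then interpret A: contaminated_pair M p\<^sub>0 p\<^sub>1 "\<epsilon>\<^sub>0 j" "\<epsilon>\<^sub>1 j" "c_lo j" "c_hi j" .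
  have "{y \<in> space M. \<phi> j y u} \<in> sets M"
    using rules j by (auto simp: decision_rules_def decision_rule_def pred_def)
  thus "(law_steps M P \<phi> j u = 0 \<longleftrightarrow> law_steps M P' \<phi> j u = 0) \<and>
      (law_steps M P \<phi> j u = 1 \<longleftrightarrow> law_steps M P' \<phi> j u = 1)"
    unfolding law_steps_def using A.class_measure_0_iff A.class_measure_1_iff P[OF j] by blast
qed

text \<open>Altering the reaction of one agent to one received decision changes the error linearly.\<close>

lemma optimal_at_of_minimal:
  assumes n: "n \<le> N" and k: "k < n" and rules: "decision_rules M n \<phi>"
    and min: "\<And>r. decision_rule M r \<Longrightarrow> lfd_error n \<phi> \<le> lfd_error n (\<phi>(Suc k := r))"
  defines "x\<^sub>0 \<equiv> law_steps M Q\<^sub>0 \<phi>" and "x\<^sub>1 \<equiv> law_steps M Q\<^sub>1 \<phi>"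
  shows "optimal_at (Suc k)
    (\<pi>\<^sub>0 * (state_weight u (propagate x\<^sub>0 0 k 0) *
      (propagate x\<^sub>0 (Suc k) (n - Suc k) 1 - propagate x\<^sub>0 (Suc k) (n - Suc k) 0)))
    (\<pi>\<^sub>1 * (state_weight u (propagate x\<^sub>1 0 k 0) *
      (propagate x\<^sub>1 (Suc k) (n - Suc k) 1 - propagate x\<^sub>1 (Suc k) (n - Suc k) 0)))
    {y \<in> space M. \<phi> (Suc k) y u}" (is "optimal_at _ (_ * ?B\<^sub>0) (_ * ?B\<^sub>1) ?S")
proof -
  have "contaminated_pair M p\<^sub>0 p\<^sub>1 (\<epsilon>\<^sub>0 (Suc k)) (\<epsilon>\<^sub>1 (Suc k)) (c_lo (Suc k)) (c_hi (Suc k))"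
    using n k by (intro pair) auto
  then interpret A: contaminated_pair M p\<^sub>0 p\<^sub>1 "\<epsilon>\<^sub>0 (Suc k)" "\<epsilon>\<^sub>1 (Suc k)" "c_lo (Suc k)" "c_hi (Suc k)" .
  have rule: "decision_rule M (\<phi> (Suc k))" using rules k by (auto simp: decision_rules_def)
  hence S: "?S \<in> sets M" by (auto simp: decision_rule_def pred_def)
  have "\<pi>\<^sub>0 * ?B\<^sub>0 * measure (Q\<^sub>0 (Suc k)) ?S - \<pi>\<^sub>1 * ?B\<^sub>1 * measure (Q\<^sub>1 (Suc k)) ?S \<le>
      \<pi>\<^sub>0 * ?B\<^sub>0 * measure (Q\<^sub>0 (Suc k)) S' - \<pi>\<^sub>1 * ?B\<^sub>1 * measure (Q\<^sub>1 (Suc k)) S'"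
    if S' [measurable]: "S' \<in> sets M" for S'
  proof -
    \<comment> \<open>Only the reaction to the received decision \<open>u\<close> is replaced, by
      the test with acceptance set \<open>S'\<close>.\<close>
    define r where "r = (\<lambda>y v. if v = u then y \<in> S' else \<phi> (Suc k) y v)"
    have r: "decision_rule M r"
      unfolding decision_rule_def
    proof
      fix v
      show "(\<lambda>y. r y v) \<in> measurable M (count_space UNIV)"
        using rule S' by (cases "v = u") (auto simp: r_def decision_rule_def)
    qed
    hence rules': "decision_rules M n (\<phi>(Suc k := r))" using rules by (auto simp: decision_rules_def)
    have x: "propagate (law_steps M Q (\<phi>(Suc k := r))) 0 n 0 - propagate (law_steps M Q \<phi>) 0 n 0 =
        state_weight u (propagate (law_steps M Q \<phi>) 0 k 0) *
        (propagate (law_steps M Q \<phi>) (Suc k) (n - Suc k) 1 - propagate (law_steps M Q \<phi>) (Suc k) (n - Suc k) 0) *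
        (measure (Q (Suc k)) S' - measure (Q (Suc k)) ?S)" for Q
      unfolding r_def law_steps_fun_upd[OF S'] propagate_upd_diff[OF k] by (simp add: law_steps_def)
    have "0 \<le> lfd_error n (\<phi>(Suc k := r)) - lfd_error n \<phi>" using min[OF r] by simp
    also have "\<dots> =
        \<pi>\<^sub>0 * (propagate (law_steps M Q\<^sub>0 (\<phi>(Suc k := r))) 0 n 0 - propagate (law_steps M Q\<^sub>0 \<phi>) 0 n 0) -
        \<pi>\<^sub>1 * (propagate (law_steps M Q\<^sub>1 (\<phi>(Suc k := r))) 0 n 0 - propagate (law_steps M Q\<^sub>1 \<phi>) 0 n 0)"
      unfolding lfd_error_eq[OF n rules] lfd_error_eq[OF n rules'] by (simp add: algebra_simps)
    also have "\<dots> = \<pi>\<^sub>0 * (?B\<^sub>0 * (measure (Q\<^sub>0 (Suc k)) S' - measure (Q\<^sub>0 (Suc k)) ?S)) -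
        \<pi>\<^sub>1 * (?B\<^sub>1 * (measure (Q\<^sub>1 (Suc k)) S' - measure (Q\<^sub>1 (Suc k)) ?S))"
      unfolding x x\<^sub>0_def x\<^sub>1_def ..
    finally have "0 \<le> \<pi>\<^sub>0 * (?B\<^sub>0 * (measure (Q\<^sub>0 (Suc k)) S' - measure (Q\<^sub>0 (Suc k)) ?S)) -
        \<pi>\<^sub>1 * (?B\<^sub>1 * (measure (Q\<^sub>1 (Suc k)) S' - measure (Q\<^sub>1 (Suc k)) ?S))" .
    moreover have "a * b * m - a' * b' * m' \<le> a * b * l - a' * b' * l'"
      if "0 \<le> a * (b * (l - m)) - a' * (b' * (l' - m'))" for a b m l a' b' m' l' :: real
      using that by (simp add: algebra_simps)
    ultimately show ?thesis by blast
  qed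
  thus ?thesis using S unfolding A.bayes_optimal_def by blast
qed

text \<open>A positive weight can be divided out of the saddle inequalities, leaving slope times
  change. The factors \<open>1\<close> and \<open>- 1\<close> match the parameter \<open>s\<close>
  of the exchange lemmas, as the two hypotheses call for opposite directions.\<close>

lemma saddle_step:
  assumes k: "Suc k \<in> {1..N}" and lr: "lr_based M (q\<^sub>0 (Suc k)) (q\<^sub>1 (Suc k)) (\<phi> (Suc k))"
    and opt: "optimal_at (Suc k) (\<pi>\<^sub>0 * (w\<^sub>0 * d\<^sub>0)) (\<pi>\<^sub>1 * (w\<^sub>1 * d\<^sub>1)) {y \<in> space M. \<phi> (Suc k) y u}"
    and P: "P\<^sub>0 (Suc k) \<in> \<P>\<^sub>0 (Suc k)" "P\<^sub>1 (Suc k) \<in> \<P>\<^sub>1 (Suc k)"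
  shows "0 < w\<^sub>0 \<Longrightarrow> 1 * (d\<^sub>0 * (law_steps M P\<^sub>0 \<phi> (Suc k) u - law_steps M Q\<^sub>0 \<phi> (Suc k) u)) \<le> 0"
    and "0 < w\<^sub>1 \<Longrightarrow> - 1 * (d\<^sub>1 * (law_steps M P\<^sub>1 \<phi> (Suc k) u - law_steps M Q\<^sub>1 \<phi> (Suc k) u)) \<le> 0"
proof -
  let ?S = "{y \<in> space M. \<phi> (Suc k) y u}"
  interpret A: contaminated_pair M p\<^sub>0 p\<^sub>1 "\<epsilon>\<^sub>0 (Suc k)" "\<epsilon>\<^sub>1 (Suc k)" "c_lo (Suc k)" "c_hi (Suc k)"
    by (rule pair[OF k])
  have inv: "A.lr_invariant ?S"
    using lr unfolding A.lr_invariant_def lr_based_def by blast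
  note s = A.bayes_optimal_saddle[OF opt inv P]
  show "1 * (d\<^sub>0 * (law_steps M P\<^sub>0 \<phi> (Suc k) u - law_steps M Q\<^sub>0 \<phi> (Suc k) u)) \<le> 0" if w: "0 < w\<^sub>0"
  proof -
    have "(\<pi>\<^sub>0 * w\<^sub>0) * (d\<^sub>0 * (measure (P\<^sub>0 (Suc k)) ?S - measure (Q\<^sub>0 (Suc k)) ?S)) \<le> 0"
      using s(1) by (simp add: algebra_simps)
    moreover have "0 < \<pi>\<^sub>0 * w\<^sub>0" using w prior by simp
    ultimately have "d\<^sub>0 * (measure (P\<^sub>0 (Suc k)) ?S - measure (Q\<^sub>0 (Suc k)) ?S) \<le> 0"
      by (meson mult_pos_pos not_le)
    thus ?thesis unfolding law_steps_def by linarith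
  qed
  show "- 1 * (d\<^sub>1 * (law_steps M P\<^sub>1 \<phi> (Suc k) u - law_steps M Q\<^sub>1 \<phi> (Suc k) u)) \<le> 0" if w: "0 < w\<^sub>1"
  proof -
    have "0 \<le> (\<pi>\<^sub>1 * w\<^sub>1) * (d\<^sub>1 * (measure (P\<^sub>1 (Suc k)) ?S - measure (Q\<^sub>1 (Suc k)) ?S))"
      using s(2) by (simp add: algebra_simps)
    moreover have "0 < \<pi>\<^sub>1 * w\<^sub>1" using w prior by simp
    ultimately have "0 \<le> d\<^sub>1 * (measure (P\<^sub>1 (Suc k)) ?S - measure (Q\<^sub>1 (Suc k)) ?S)"
      by (meson mult_pos_neg not_le)
    thus ?thesis unfolding law_steps_def by linarith
  qed
qed

section \<open>The least favorable laws attain the worst case\<close>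

lemma worst_error_le_of_optimal:
  assumes rules: "decision_rules M N \<phi>"
    and min: "\<And>\<phi>'. decision_rules M N \<phi>' \<Longrightarrow> lfd_error N \<phi> \<le> lfd_error N \<phi>'"
    and lr: "\<And>k. k \<in> {1..N} \<Longrightarrow> lr_based M (q\<^sub>0 k) (q\<^sub>1 k) (\<phi> k)"
  shows "worst_error N \<phi> \<le> lfd_error N \<phi>"
proof (rule worst_error_le[OF order_refl rules])
  fix P\<^sub>0 P\<^sub>1 :: "nat \<Rightarrow> 'y measure"
  assume P: "\<And>j. j \<in> {1..N} \<Longrightarrow> P\<^sub>0 j \<in> \<P>\<^sub>0 j" "\<And>j. j \<in> {1..N} \<Longrightarrow> P\<^sub>1 j \<in> \<P>\<^sub>1 j"
  have b: "step_probs (law_steps M P \<phi>) N" if "\<And>j. j \<in> {1..N} \<Longrightarrow> P j \<in> \<P>\<^sub>0 j \<union> \<P>\<^sub>1 j" for P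
    using class_laws that by (intro law_steps_bounds) blast
  have eq: "equiv_steps (law_steps M P\<^sub>0 \<phi>) (law_steps M Q\<^sub>0 \<phi>) N"
    "equiv_steps (law_steps M P\<^sub>1 \<phi>) (law_steps M Q\<^sub>1 \<phi>) N"
    using P lfd_in_class by (auto intro!: class_equiv_steps[OF rules])
  \<comment> \<open>Global optimality enters through deviations by a single agent.\<close>
  have opt: "lfd_error N \<phi> \<le> lfd_error N (\<phi>(Suc k := r))" if "decision_rule M r" for k r
    using rules that by (intro min) (auto simp: decision_rules_def)
  let ?d = "\<lambda>Q k. propagate (law_steps M Q \<phi>) (Suc k) (N - Suc k) 1 - propagate (law_steps M Q \<phi>) (Suc k) (N - Suc k) 0"
  have step: "0 < state_weight u (propagate (law_steps M Q\<^sub>0 \<phi>) 0 k 0) \<Longrightarrow>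
      1 * (?d Q\<^sub>0 k * (law_steps M P\<^sub>0 \<phi> (Suc k) u - law_steps M Q\<^sub>0 \<phi> (Suc k) u)) \<le> 0"
    "0 < state_weight u (propagate (law_steps M Q\<^sub>1 \<phi>) 0 k 0) \<Longrightarrow>
      - 1 * (?d Q\<^sub>1 k * (law_steps M P\<^sub>1 \<phi> (Suc k) u - law_steps M Q\<^sub>1 \<phi> (Suc k) u)) \<le> 0"
    if k: "k < N" for k u
  proof -
    have k': "Suc k \<in> {1..N}" using k by simp
    note s = saddle_step[where k = k and \<phi> = \<phi> and u = u and P\<^sub>0 = P\<^sub>0 and P\<^sub>1 = P\<^sub>1, OF k' lr[OF k'] optimal_at_of_minimal[OF order_refl k rules opt] P(1)[OF k'] P(2)[OF k']]
    show "0 < state_weight u (propagate (law_steps M Q\<^sub>0 \<phi>) 0 k 0) \<Longrightarrow>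
        1 * (?d Q\<^sub>0 k * (law_steps M P\<^sub>0 \<phi> (Suc k) u - law_steps M Q\<^sub>0 \<phi> (Suc k) u)) \<le> 0"
      by (rule s(1))
    show "0 < state_weight u (propagate (law_steps M Q\<^sub>1 \<phi>) 0 k 0) \<Longrightarrow>
        - 1 * (?d Q\<^sub>1 k * (law_steps M P\<^sub>1 \<phi> (Suc k) u - law_steps M Q\<^sub>1 \<phi> (Suc k) u)) \<le> 0"
      by (rule s(2))
  qed
  have "1 * propagate (law_steps M P\<^sub>0 \<phi>) 0 N 0 \<le> 1 * propagate (law_steps M Q\<^sub>0 \<phi>) 0 N 0"
    using lfd_in_class P by (intro propagate_exchange[OF b b eq(1)] step(1)) auto
  moreover have "- 1 * propagate (law_steps M P\<^sub>1 \<phi>) 0 N 0 \<le> - 1 * propagate (law_steps M Q\<^sub>1 \<phi>) 0 N 0"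
    using lfd_in_class P by (intro propagate_exchange[OF b b eq(2)] step(2)) auto
  ultimately show "propagate (law_steps M P\<^sub>0 \<phi>) 0 N 0 \<le> propagate (law_steps M Q\<^sub>0 \<phi>) 0 N 0 \<and>
      propagate (law_steps M Q\<^sub>1 \<phi>) 0 N 0 \<le> propagate (law_steps M P\<^sub>1 \<phi>) 0 N 0" by simp
qed

text \<open>Each agent minimizes its own error, so optimality does not control its influence on
  later agents. Separation of the two hypotheses yields the monotone steps that replace this
  control.\<close>

lemma worst_error_le_of_myopic:
  assumes n: "n \<le> N" and rules: "decision_rules M n \<psi>"
    and min: "\<And>k r. k < n \<Longrightarrow> decision_rule M r \<Longrightarrow> lfd_error (Suc k) \<psi> \<le> lfd_error (Suc k) (\<psi>(Suc k := r))"
    and lr: "\<And>k. k \<in> {1..n} \<Longrightarrow> lr_based M (q\<^sub>0 k) (q\<^sub>1 k) (\<psi> k)"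
  shows "worst_error n \<psi> \<le> lfd_error n \<psi>"
proof -
  define x\<^sub>0 x\<^sub>1 where x: "x\<^sub>0 = law_steps M Q\<^sub>0 \<psi>" "x\<^sub>1 = law_steps M Q\<^sub>1 \<psi>"
  define R\<^sub>0 R\<^sub>1 where R: "R\<^sub>0 k = propagate x\<^sub>0 0 k 0" "R\<^sub>1 k = propagate x\<^sub>1 0 k 0" for k
  let ?S = "\<lambda>k u. {y \<in> space M. \<psi> (Suc k) y u}"
  have laws: "prob_space (Q\<^sub>0 j) \<and> sets (Q\<^sub>0 j) = sets M" "prob_space (Q\<^sub>1 j) \<and> sets (Q\<^sub>1 j) = sets M"
    if "j \<in> {1..n}" for j
    using that n lfd_in_class[of j] class_laws[of "Q\<^sub>0 j" j] class_laws[of "Q\<^sub>1 j" j] by auto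
  have b: "step_probs x\<^sub>0 n" "step_probs x\<^sub>1 n"
    unfolding x by (rule law_steps_bounds; use laws in blast)+
  have eq: "equiv_steps x\<^sub>0 x\<^sub>1 n"
    unfolding x using lfd_in_class n by (intro class_equiv_steps[OF rules n]) auto
  have R_bounds: "0 \<le> R\<^sub>0 k" "R\<^sub>0 k \<le> 1" "0 \<le> R\<^sub>1 k" "R\<^sub>1 k \<le> 1" if "k \<le> n" for k
    using propagate_bounds[OF b(1) that] propagate_bounds[OF b(2) that] by (auto simp: R)
  have R_pos: "0 < R\<^sub>0 k" "R\<^sub>1 k < 1" if "k \<le> n" "R\<^sub>0 k < R\<^sub>1 k" for k
    using equiv_steps_propagate[OF b eq that(1)] R_bounds[OF that(1)] that(2) by (auto simp: R less_le)
  \<comment> \<open>The factor \<open>1\<close> is the slope of the empty chain after the agent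
    whose error is minimized, so both coefficients are nonnegative.\<close>
  have opt: "optimal_at (Suc k) (\<pi>\<^sub>0 * (state_weight u (R\<^sub>0 k) * 1)) (\<pi>\<^sub>1 * (state_weight u (R\<^sub>1 k) * 1)) (?S k u)"
    if k: "k < n" for k u
  proof -
    have "Suc k \<le> N" "decision_rules M (Suc k) \<psi>" using k n rules by (auto simp: decision_rules_def)
    from optimal_at_of_minimal[OF this(1) _ this(2) min[OF k], where u = u]
    show ?thesis by (simp add: x R)
  qed
  have mono: "x\<^sub>0 (Suc k) False \<le> x\<^sub>0 (Suc k) True" "x\<^sub>1 (Suc k) False \<le> x\<^sub>1 (Suc k) True"
    if k: "k < n" and less: "R\<^sub>0 k < R\<^sub>1 k" for k
  proof -
    have "contaminated_pair M p\<^sub>0 p\<^sub>1 (\<epsilon>\<^sub>0 (Suc k)) (\<epsilon>\<^sub>1 (Suc k)) (c_lo (Suc k)) (c_hi (Suc k))"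
      using n k by (intro pair) auto
    then interpret A: contaminated_pair M p\<^sub>0 p\<^sub>1 "\<epsilon>\<^sub>0 (Suc k)" "\<epsilon>\<^sub>1 (Suc k)" "c_lo (Suc k)" "c_hi (Suc k)" .
    have p: "0 < R\<^sub>0 k" "R\<^sub>1 k < 1" using R_pos[OF _ less] k by auto
    \<comment> \<open>This is the difference of the cross products comparing the thresholds after a
      received 0 and a received 1.\<close>
    have "0 < \<pi>\<^sub>0 * \<pi>\<^sub>1 * (R\<^sub>1 k - R\<^sub>0 k)" using less prior by simp
    hence "\<pi>\<^sub>0 * (state_weight True (R\<^sub>0 k) * 1) * (\<pi>\<^sub>1 * (state_weight False (R\<^sub>1 k) * 1)) <
        \<pi>\<^sub>0 * (state_weight False (R\<^sub>0 k) * 1) * (\<pi>\<^sub>1 * (state_weight True (R\<^sub>1 k) * 1))"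
      by (simp add: state_weight_def algebra_simps)
    from A.bayes_optimal_mono[OF opt[OF k, of False] opt[OF k, of True] _ _ _ _ this]
    show "x\<^sub>0 (Suc k) False \<le> x\<^sub>0 (Suc k) True" "x\<^sub>1 (Suc k) False \<le> x\<^sub>1 (Suc k) True"
      using p less prior by (simp_all add: x law_steps_def state_weight_def)
  qed
  have sep: "separated (R\<^sub>0 k) (R\<^sub>1 k)" if "k \<le> n" for k
    using that
  proof (induction k)
    case (Suc k)
    hence k: "k < n" by simp
    have "contaminated_pair M p\<^sub>0 p\<^sub>1 (\<epsilon>\<^sub>0 (Suc k)) (\<epsilon>\<^sub>1 (Suc k)) (c_lo (Suc k)) (c_hi (Suc k))"
      using n k by (intro pair) auto
    then interpret A: contaminated_pair M p\<^sub>0 p\<^sub>1 "\<epsilon>\<^sub>0 (Suc k)" "\<epsilon>\<^sub>1 (Suc k)" "c_lo (Suc k)" "c_hi (Suc k)" .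
    have "separated (transition (x\<^sub>0 (Suc k)) (R\<^sub>0 k)) (transition (x\<^sub>1 (Suc k)) (R\<^sub>1 k))"
    proof (rule separated_transition)
      show "separated (R\<^sub>0 k) (R\<^sub>1 k)" using Suc by simp
      show "separated (x\<^sub>0 (Suc k) u) (x\<^sub>1 (Suc k) u)"
        if "0 < state_weight u (R\<^sub>0 k)" "0 < state_weight u (R\<^sub>1 k)" for u
        using A.bayes_optimal_separates[OF opt[OF k, of u]] that prior
        unfolding separated_def x law_steps_def by simp
    qed (use R_pos[of k] mono[OF k] k in auto)
    thus ?case by (simp add: R propagate_Suc del: propagate.simps)
  qed (simp add: R separated_def)
  show ?thesis
  proof (rule worst_error_le[OF n rules])
    fix P\<^sub>0 P\<^sub>1 :: "nat \<Rightarrow> 'y measure"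
    assume P: "\<And>j. j \<in> {1..n} \<Longrightarrow> P\<^sub>0 j \<in> \<P>\<^sub>0 j" "\<And>j. j \<in> {1..n} \<Longrightarrow> P\<^sub>1 j \<in> \<P>\<^sub>1 j"
    have b': "step_probs (law_steps M P\<^sub>0 \<psi>) n" "step_probs (law_steps M P\<^sub>1 \<psi>) n"
      by (rule law_steps_bounds; use class_laws P in blast)+
    have eq': "equiv_steps (law_steps M P\<^sub>0 \<psi>) x\<^sub>0 n" "equiv_steps (law_steps M P\<^sub>1 \<psi>) x\<^sub>1 n"
      unfolding x using P lfd_in_class n by (auto intro!: class_equiv_steps[OF rules n])
    have step: "0 < state_weight u (propagate x\<^sub>0 0 k 0) \<Longrightarrow> 1 * (law_steps M P\<^sub>0 \<psi> (Suc k) u - x\<^sub>0 (Suc k) u) \<le> 0"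
      "0 < state_weight u (propagate x\<^sub>1 0 k 0) \<Longrightarrow> - 1 * (law_steps M P\<^sub>1 \<psi> (Suc k) u - x\<^sub>1 (Suc k) u) \<le> 0"
      if k: "k < n" for k u
    proof -
      have k': "Suc k \<in> {1..n}" "Suc k \<in> {1..N}" using k n by auto
      note s = saddle_step[where k = k and \<phi> = \<psi> and u = u and P\<^sub>0 = P\<^sub>0 and P\<^sub>1 = P\<^sub>1,
          OF k'(2) lr[OF k'(1)] opt[OF k] P(1)[OF k'(1)] P(2)[OF k'(1)]]
      show "0 < state_weight u (propagate x\<^sub>0 0 k 0) \<Longrightarrow> 1 * (law_steps M P\<^sub>0 \<psi> (Suc k) u - x\<^sub>0 (Suc k) u) \<le> 0"
        using s(1) unfolding x R by simp
      show "0 < state_weight u (propagate x\<^sub>1 0 k 0) \<Longrightarrow> - 1 * (law_steps M P\<^sub>1 \<psi> (Suc k) u - x\<^sub>1 (Suc k) u) \<le> 0"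
        using s(2) unfolding x R by simp
    qed
    \<comment> \<open>Uncertainty under either law excludes the deterministic cases of separation,
      so monotonicity is available.\<close>
    have less: "R\<^sub>0 k < R\<^sub>1 k" if "k < n" "0 < R\<^sub>0 k \<and> R\<^sub>0 k < 1 \<or> 0 < R\<^sub>1 k \<and> R\<^sub>1 k < 1" for k
      using sep[of k] that by (auto simp: separated_def)
    have "1 * propagate (law_steps M P\<^sub>0 \<psi>) 0 n 0 \<le> 1 * propagate x\<^sub>0 0 n 0"
      by (rule propagate_mono_exchange[OF b(1) b'(1) eq'(1) mono(1)[OF _ less] step(1)]) (auto simp: R)
    moreover have "- 1 * propagate (law_steps M P\<^sub>1 \<psi>) 0 n 0 \<le> - 1 * propagate x\<^sub>1 0 n 0"
      by (rule propagate_mono_exchange[OF b(2) b'(2) eq'(2) mono(2)[OF _ less] step(2)]) (auto simp: R)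
    ultimately show "propagate (law_steps M P\<^sub>0 \<psi>) 0 n 0 \<le> propagate (law_steps M Q\<^sub>0 \<psi>) 0 n 0 \<and>
        propagate (law_steps M Q\<^sub>1 \<psi>) 0 n 0 \<le> propagate (law_steps M P\<^sub>1 \<psi>) 0 n 0" by (simp add: x)
  qed
qed

section \<open>Minimax optimality for both criteria\<close>

lemma minimax_DD:
  assumes "is_arg_min (lfd_error N) (decision_rules M N) \<phi>"
    and "\<forall>k\<in>{1..N}. lr_based M (q\<^sub>0 k) (q\<^sub>1 k) (\<phi> k)"
  shows "is_arg_min (worst_error N) (decision_rules M N) \<phi>"
proof -
  have rules: "decision_rules M N \<phi>"
    and min: "\<And>\<phi>'. decision_rules M N \<phi>' \<Longrightarrow> lfd_error N \<phi> \<le> lfd_error N \<phi>'"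
    using assms(1) by (auto simp: is_arg_min_linorder)
  have "worst_error N \<phi> \<le> worst_error N \<phi>'" if "decision_rules M N \<phi>'" for \<phi>'
  proof -
    \<comment> \<open>The saddle point chain: the least favorable pair is worst for
      \<open>\<phi>\<close>, \<open>\<phi>\<close> is best against that pair, and the pair is one of
      the candidates in the supremum for \<open>\<phi>'\<close>.\<close>
    have "worst_error N \<phi> \<le> lfd_error N \<phi>"
      using rules min assms(2) by (intro worst_error_le_of_optimal) blast+
    also have "\<dots> \<le> lfd_error N \<phi>'" by (rule min[OF that])
    also have "\<dots> \<le> worst_error N \<phi>'" by (rule lfd_error_le_worst[OF order_refl that])
    finally show ?thesis .
  qed
  thus ?thesis using rules by (simp add: is_arg_min_linorder)
qed

lemma minimax_SL:
  assumes "\<forall>k\<in>{1..N}. is_arg_min (\<lambda>r. lfd_error k (\<psi>(k := r))) (decision_rule M) (\<psi> k) \<and>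
      lr_based M (q\<^sub>0 k) (q\<^sub>1 k) (\<psi> k)"
    and k: "k \<in> {1..N}"
  shows "is_arg_min (SL_risk \<pi>\<^sub>0 \<pi>\<^sub>1 \<P>\<^sub>0 \<P>\<^sub>1 k \<psi>) (decision_rule M) (\<psi> k)"
proof -
  have rule: "decision_rule M (\<psi> j)" and lr: "lr_based M (q\<^sub>0 j) (q\<^sub>1 j) (\<psi> j)"
    and min: "decision_rule M r \<Longrightarrow> lfd_error j \<psi> \<le> lfd_error j (\<psi>(j := r))" if "j \<in> {1..N}" for j r
    using assms(1) that by (auto simp: is_arg_min_linorder)
  have rules: "decision_rules M k \<psi>" using rule k by (auto simp: decision_rules_def)
  \<comment> \<open>The social learning criterion is the decentralized one for a network ending at
    agent \<open>k\<close>, with only the last rule free.\<close>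
  have SL: "SL_risk \<pi>\<^sub>0 \<pi>\<^sub>1 \<P>\<^sub>0 \<P>\<^sub>1 k \<psi> r = worst_error k (\<psi>(k := r))" for r
    by (simp add: SL_risk_def DD_risk_def)
  have "worst_error k \<psi> \<le> worst_error k (\<psi>(k := r))" if r: "decision_rule M r" for r
  proof -
    have "worst_error k \<psi> \<le> lfd_error k \<psi>"
      using rules min lr k by (intro worst_error_le_of_myopic) auto
    also have "\<dots> \<le> lfd_error k (\<psi>(k := r))" by (rule min[OF k r])
    also have "\<dots> \<le> worst_error k (\<psi>(k := r))"
      using rules r k by (intro lfd_error_le_worst) (auto simp: decision_rules_def)
    finally show ?thesis .
  qed
  thus ?thesis using rule[OF k] by (simp add: is_arg_min_linorder SL)
qed

end

theorem theorem2:
  fixes M :: "'y measure"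
    and N :: nat
    and \<pi>\<^sub>0 \<pi>\<^sub>1 :: real
    and Pst\<^sub>0 Pst\<^sub>1 :: "'y measure"
    and p\<^sub>0 p\<^sub>1 :: "'y \<Rightarrow> ennreal"
    and \<epsilon>\<^sub>0 \<epsilon>\<^sub>1 :: "nat \<Rightarrow> real"
    and \<P>\<^sub>0 \<P>\<^sub>1 :: "nat \<Rightarrow> 'y measure set"
    and c_lo c_hi :: "nat \<Rightarrow> ennreal"
    and q\<^sub>0 q\<^sub>1 :: "nat \<Rightarrow> 'y \<Rightarrow> ennreal"
    and Q\<^sub>0 Q\<^sub>1 :: "nat \<Rightarrow> 'y measure"
  defines "\<P>\<^sub>0 \<equiv> \<lambda>k. contamination_class (\<epsilon>\<^sub>0 k) Pst\<^sub>0"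
    and "\<P>\<^sub>1 \<equiv> \<lambda>k. contamination_class (\<epsilon>\<^sub>1 k) Pst\<^sub>1"
    and "q\<^sub>0 \<equiv> \<lambda>k. lfd_density0 (\<epsilon>\<^sub>0 k) (c_hi k) p\<^sub>0 p\<^sub>1"
    and "q\<^sub>1 \<equiv> \<lambda>k. lfd_density1 (\<epsilon>\<^sub>1 k) (c_lo k) p\<^sub>0 p\<^sub>1"
    and "Q\<^sub>0 \<equiv> \<lambda>k. density M (q\<^sub>0 k)"
    and "Q\<^sub>1 \<equiv> \<lambda>k. density M (q\<^sub>1 k)"
  assumes "1 \<le> N"
    and "0 < \<pi>\<^sub>0" "\<pi>\<^sub>0 < 1" "0 < \<pi>\<^sub>1" "\<pi>\<^sub>1 < 1" "\<pi>\<^sub>0 + \<pi>\<^sub>1 = 1"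
    and "p\<^sub>0 \<in> borel_measurable M" "p\<^sub>1 \<in> borel_measurable M"
    and "Pst\<^sub>0 = density M p\<^sub>0" "Pst\<^sub>1 = density M p\<^sub>1"
    and "prob_space Pst\<^sub>0" "prob_space Pst\<^sub>1"
    and "\<And>k. k \<in> {1..N} \<Longrightarrow> 0 \<le> \<epsilon>\<^sub>0 k \<and> \<epsilon>\<^sub>0 k < 1"
    and "\<And>k. k \<in> {1..N} \<Longrightarrow> 0 \<le> \<epsilon>\<^sub>1 k \<and> \<epsilon>\<^sub>1 k < 1"
    and "\<And>k. k \<in> {1..N} \<Longrightarrow> \<P>\<^sub>0 k \<inter> \<P>\<^sub>1 k = {}"
    and "\<And>k P P'. k \<in> {1..N} \<Longrightarrow> P \<in> \<P>\<^sub>0 k \<union> \<P>\<^sub>1 k \<Longrightarrow> P' \<in> \<P>\<^sub>0 k \<union> \<P>\<^sub>1 k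
           \<Longrightarrow> absolutely_continuous P P'"
    and "\<And>k. k \<in> {1..N} \<Longrightarrow> c_lo k < c_hi k"
    and "\<And>k. k \<in> {1..N} \<Longrightarrow> (\<integral>\<^sup>+ y. q\<^sub>0 k y \<partial>M) = 1"
    and "\<And>k. k \<in> {1..N} \<Longrightarrow> (\<integral>\<^sup>+ y. q\<^sub>1 k y \<partial>M) = 1"
  shows "(\<forall>\<phi>. is_arg_min (\<lambda>\<phi>. error_prob \<pi>\<^sub>0 \<pi>\<^sub>1 N \<phi> (PiM {1..N} Q\<^sub>0) (PiM {1..N} Q\<^sub>1))
                 (decision_rules M N) \<phi> \<and>
               (\<forall>k\<in>{1..N}. lr_based M (q\<^sub>0 k) (q\<^sub>1 k) (\<phi> k))
           \<longrightarrow> is_arg_min (DD_risk \<pi>\<^sub>0 \<pi>\<^sub>1 \<P>\<^sub>0 \<P>\<^sub>1 N) (decision_rules M N) \<phi>)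
       \<and> (\<forall>\<psi>. (\<forall>k\<in>{1..N}.
                  is_arg_min (\<lambda>r. error_prob \<pi>\<^sub>0 \<pi>\<^sub>1 k (\<psi>(k := r)) (PiM {1..k} Q\<^sub>0) (PiM {1..k} Q\<^sub>1))
                    (decision_rule M) (\<psi> k) \<and>
                  lr_based M (q\<^sub>0 k) (q\<^sub>1 k) (\<psi> k))
           \<longrightarrow> (\<forall>k\<in>{1..N}. is_arg_min (SL_risk \<pi>\<^sub>0 \<pi>\<^sub>1 \<P>\<^sub>0 \<P>\<^sub>1 k \<psi>) (decision_rule M) (\<psi> k)))"
proof -
  \<comment> \<open>After unfolding, the first six facts concern the nominal densities and laws;
    from the seventh on, each is a statement about one agent.\<close>
  note facts = assms(13-)[unfolded \<P>\<^sub>0_def \<P>\<^sub>1_def q\<^sub>0_def q\<^sub>1_def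
      \<open>Pst\<^sub>0 = density M p\<^sub>0\<close> \<open>Pst\<^sub>1 = density M p\<^sub>1\<close>]
  interpret T: tandem M N \<pi>\<^sub>0 \<pi>\<^sub>1 p\<^sub>0 p\<^sub>1 \<epsilon>\<^sub>0 \<epsilon>\<^sub>1 c_lo c_hi
  proof (rule tandem.intro)
    fix k assume k: "k \<in> {1..N}"
    note agent = facts(7-)[OF k]
    show "contaminated_pair M p\<^sub>0 p\<^sub>1 (\<epsilon>\<^sub>0 k) (\<epsilon>\<^sub>1 k) (c_lo k) (c_hi k)"
      by (rule contaminated_pair.intro)
         (fact facts(1,2,5,6) agent agent(1,2)[THEN conjunct1] agent(1,2)[THEN conjunct2])+
  qed fact+
  show ?thesis
    unfolding \<P>\<^sub>0_def \<P>\<^sub>1_def q\<^sub>0_def q\<^sub>1_def Q\<^sub>0_def Q\<^sub>1_def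
      \<open>Pst\<^sub>0 = density M p\<^sub>0\<close> \<open>Pst\<^sub>1 = density M p\<^sub>1\<close>
    using T.minimax_DD T.minimax_SL by blast
qed

end
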